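(* The set $D^2(A_1)=\{\alpha\in\mathcal N:\alpha^0=\underline0\ \vee\ \alpha^1=\underline0\}$ positively fails to be regular in Lusin's sense: for every spread $F\subseteq\mathcal N$ and every $\gamma$ coding a continuous function from $F$ to $\mathcal N$ that maps $F$ onto $D^2(A_1)$, there exist $\alpha,\beta\in F$ such that $\alpha\#\beta$ and $\gamma|\alpha=\gamma|\beta$.
   Context: Framework: Brouwer's intuitionistic analysis (intuitionistic logic, countable choice, Brouwer's Continuity Principle (also for spreads), axioms of continuous choice, Thesis on Bars, Fan Theorem). $\mathcal N=\mathbb N^{\mathbb N}$; finite sequences coded by numbers, $\overline\alpha n=\langle\alpha(0),\dots,\alpha(n-1)\rangle$, $\alpha^m(k)=\alpha(\langle m\rangle*k)$, $\underline0$ the zero sequence. $\alpha\#\beta$ iff $\exists n\,\alpha(n)\ne\beta(n)$. A spread is a set $F=\{\alpha:\forall n\,\beta(\overline\alpha n)=0\}$ where $\beta$ satisfies $\forall s[\beta(s)=0\leftrightarrow\exists n\,\beta(s*\langle n\rangle)=0]$. $\gamma$ codes a continuous function from $F$ to $\mathcal N$ iff for each $n$, $\forall\alpha\in F\,\exists m\,\gamma^n(\overline\alpha m)\ne0$; then $(\gamma|\alpha)(n)=p$ where the first nonzero value $\gamma^n(\overline\alpha m)$ is $p+1$. Onto $D^2(A_1)$ means $\{\gamma|\alpha:\alpha\in F\}=D^2(A_1)$. *)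

theory Defs
  imports Main
begin

text \<open>
  HOL is classical, and read directly in HOL the statement at hand is false: classically the set
  \<open>D\<^sup>2(A\<^sub>1)\<close> is closed, hence itself a spread, and the identity is a continuous injection of it onto
  itself. Brouwer's intuitionistic analysis is therefore represented as a formal theory (two-sorted
  intuitionistic predicate logic plus Brouwer's axioms), and its theorems as derivable formulas.

  There are two sorts, natural numbers and infinite sequences of natural numbers. Variables are de
  Bruijn indices, counted separately for the two sorts: \<open>NVar i\<close> skips the \<open>i\<close> innermost
  \<^emph>\<open>number\<close> binders, \<open>SVar i\<close> the \<open>i\<close> innermost \<^emph>\<open>sequence\<close> binders.
\<close>

text \<open>
  Every natural number codes a finite sequence: \<open>Zero\<close> codes the empty one, \<open>Cns m s\<close> codes
  \<open>\<langle>m\<rangle>*s\<close>, and \<open>Append s t\<close> codes \<open>s*t\<close>. The coding is only fixed by its axioms (in \<open>ax\<close> below).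
  \<open>Rec a b n\<close> is the value at \<open>n\<close> of the function defined by primitive recursion with initial
  value \<open>a\<close> and step \<open>b\<close>; in \<open>b\<close>, \<open>NVar 0\<close> is the previous value and \<open>NVar 1\<close> its index.
  \<open>Lam t\<close> is the sequence \<open>\<lambda>n. t\<close> (binding \<open>NVar 0\<close>), \<open>Ap a n\<close> is \<open>a(n)\<close>.
\<close>

datatype ntm =
    NVar nat
  | Zero
  | Succ ntm
  | Cns ntm ntm
  | Hd ntm
  | Tl ntm
  | Append ntm ntm
  | Rec ntm ntm ntm
  | Ap stm ntm
and stm =
    SVar nat
  | Lam ntm

datatype fm =
    Eq ntm ntm  (infix \<open>\<^bold>=\<close> 50)
  | Fls
  | And fm fm  (infixr \<open>\<^bold>\<and>\<close> 35)
  | Or fm fm  (infixr \<open>\<^bold>\<or>\<close> 30)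
  | Imp fm fm  (infixr \<open>\<^bold>\<longrightarrow>\<close> 25)
  | AllN fm
  | ExN fm
  | AllS fm
  | ExS fm

definition Neg :: "fm \<Rightarrow> fm"  (\<open>\<^bold>\<not> _\<close> [40] 40)
  where "(\<^bold>\<not> \<phi>) = (\<phi> \<^bold>\<longrightarrow> Fls)"

definition Iff :: "fm \<Rightarrow> fm \<Rightarrow> fm"  (infixr \<open>\<^bold>\<longleftrightarrow>\<close> 25)
  where "(\<phi> \<^bold>\<longleftrightarrow> \<psi>) = ((\<phi> \<^bold>\<longrightarrow> \<psi>) \<^bold>\<and> (\<psi> \<^bold>\<longrightarrow> \<phi>))"


section \<open>Renaming and substitution\<close>

text \<open>In all functions below the first argument acts on number variables, the second on sequence
  variables.\<close>

abbreviation up :: "(nat \<Rightarrow> nat) \<Rightarrow> nat \<Rightarrow> nat"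
  where "up r \<equiv> case_nat 0 (\<lambda>i. Suc (r i))"

primrec ren_n :: "(nat \<Rightarrow> nat) \<Rightarrow> (nat \<Rightarrow> nat) \<Rightarrow> ntm \<Rightarrow> ntm"
  and ren_s :: "(nat \<Rightarrow> nat) \<Rightarrow> (nat \<Rightarrow> nat) \<Rightarrow> stm \<Rightarrow> stm"
where
  "ren_n r q (NVar i) = NVar (r i)"
| "ren_n r q Zero = Zero"
| "ren_n r q (Succ t) = Succ (ren_n r q t)"
| "ren_n r q (Cns t u) = Cns (ren_n r q t) (ren_n r q u)"
| "ren_n r q (Hd t) = Hd (ren_n r q t)"
| "ren_n r q (Tl t) = Tl (ren_n r q t)"
| "ren_n r q (Append t u) = Append (ren_n r q t) (ren_n r q u)"
| "ren_n r q (Rec a b n) = Rec (ren_n r q a) (ren_n (up (up r)) q b) (ren_n r q n)"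
| "ren_n r q (Ap a t) = Ap (ren_s r q a) (ren_n r q t)"
| "ren_s r q (SVar i) = SVar (q i)"
| "ren_s r q (Lam t) = Lam (ren_n (up r) q t)"

primrec ren :: "(nat \<Rightarrow> nat) \<Rightarrow> (nat \<Rightarrow> nat) \<Rightarrow> fm \<Rightarrow> fm"
where
  "ren r q (t \<^bold>= u) = (ren_n r q t \<^bold>= ren_n r q u)"
| "ren r q Fls = Fls"
| "ren r q (\<phi> \<^bold>\<and> \<psi>) = (ren r q \<phi> \<^bold>\<and> ren r q \<psi>)"
| "ren r q (\<phi> \<^bold>\<or> \<psi>) = (ren r q \<phi> \<^bold>\<or> ren r q \<psi>)"
| "ren r q (\<phi> \<^bold>\<longrightarrow> \<psi>) = (ren r q \<phi> \<^bold>\<longrightarrow> ren r q \<psi>)"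
| "ren r q (AllN \<phi>) = AllN (ren (up r) q \<phi>)"
| "ren r q (ExN \<phi>) = ExN (ren (up r) q \<phi>)"
| "ren r q (AllS \<phi>) = AllS (ren r (up q) \<phi>)"
| "ren r q (ExS \<phi>) = ExS (ren r (up q) \<phi>)"

text \<open>Weakening by one number variable (\<open>N\<close>) or one sequence variable (\<open>S\<close>).\<close>

abbreviation wkN_n :: "ntm \<Rightarrow> ntm" where "wkN_n \<equiv> ren_n Suc id"
abbreviation wkN_s :: "stm \<Rightarrow> stm" where "wkN_s \<equiv> ren_s Suc id"
abbreviation wkN :: "fm \<Rightarrow> fm" where "wkN \<equiv> ren Suc id"
abbreviation wkS_n :: "ntm \<Rightarrow> ntm" where "wkS_n \<equiv> ren_n id Suc"
abbreviation wkS_s :: "stm \<Rightarrow> stm" where "wkS_s \<equiv> ren_s id Suc"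
abbreviation wkS :: "fm \<Rightarrow> fm" where "wkS \<equiv> ren id Suc"

abbreviation upN :: "(nat \<Rightarrow> ntm) \<Rightarrow> nat \<Rightarrow> ntm"
  where "upN \<sigma> \<equiv> case_nat (NVar 0) (\<lambda>i. wkN_n (\<sigma> i))"

abbreviation upS :: "(nat \<Rightarrow> stm) \<Rightarrow> nat \<Rightarrow> stm"
  where "upS \<tau> \<equiv> case_nat (SVar 0) (\<lambda>i. wkS_s (\<tau> i))"

primrec sub_n :: "(nat \<Rightarrow> ntm) \<Rightarrow> (nat \<Rightarrow> stm) \<Rightarrow> ntm \<Rightarrow> ntm"
  and sub_s :: "(nat \<Rightarrow> ntm) \<Rightarrow> (nat \<Rightarrow> stm) \<Rightarrow> stm \<Rightarrow> stm"
where
  "sub_n \<sigma> \<tau> (NVar i) = \<sigma> i"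
| "sub_n \<sigma> \<tau> Zero = Zero"
| "sub_n \<sigma> \<tau> (Succ t) = Succ (sub_n \<sigma> \<tau> t)"
| "sub_n \<sigma> \<tau> (Cns t u) = Cns (sub_n \<sigma> \<tau> t) (sub_n \<sigma> \<tau> u)"
| "sub_n \<sigma> \<tau> (Hd t) = Hd (sub_n \<sigma> \<tau> t)"
| "sub_n \<sigma> \<tau> (Tl t) = Tl (sub_n \<sigma> \<tau> t)"
| "sub_n \<sigma> \<tau> (Append t u) = Append (sub_n \<sigma> \<tau> t) (sub_n \<sigma> \<tau> u)"
| "sub_n \<sigma> \<tau> (Rec a b n) =
     Rec (sub_n \<sigma> \<tau> a) (sub_n (upN (upN \<sigma>)) (\<lambda>i. wkN_s (wkN_s (\<tau> i))) b) (sub_n \<sigma> \<tau> n)"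
| "sub_n \<sigma> \<tau> (Ap a t) = Ap (sub_s \<sigma> \<tau> a) (sub_n \<sigma> \<tau> t)"
| "sub_s \<sigma> \<tau> (SVar i) = \<tau> i"
| "sub_s \<sigma> \<tau> (Lam t) = Lam (sub_n (upN \<sigma>) (\<lambda>i. wkN_s (\<tau> i)) t)"

primrec sub :: "(nat \<Rightarrow> ntm) \<Rightarrow> (nat \<Rightarrow> stm) \<Rightarrow> fm \<Rightarrow> fm"
where
  "sub \<sigma> \<tau> (t \<^bold>= u) = (sub_n \<sigma> \<tau> t \<^bold>= sub_n \<sigma> \<tau> u)"
| "sub \<sigma> \<tau> Fls = Fls"
| "sub \<sigma> \<tau> (\<phi> \<^bold>\<and> \<psi>) = (sub \<sigma> \<tau> \<phi> \<^bold>\<and> sub \<sigma> \<tau> \<psi>)"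
| "sub \<sigma> \<tau> (\<phi> \<^bold>\<or> \<psi>) = (sub \<sigma> \<tau> \<phi> \<^bold>\<or> sub \<sigma> \<tau> \<psi>)"
| "sub \<sigma> \<tau> (\<phi> \<^bold>\<longrightarrow> \<psi>) = (sub \<sigma> \<tau> \<phi> \<^bold>\<longrightarrow> sub \<sigma> \<tau> \<psi>)"
| "sub \<sigma> \<tau> (AllN \<phi>) = AllN (sub (upN \<sigma>) (\<lambda>i. wkN_s (\<tau> i)) \<phi>)"
| "sub \<sigma> \<tau> (ExN \<phi>) = ExN (sub (upN \<sigma>) (\<lambda>i. wkN_s (\<tau> i)) \<phi>)"
| "sub \<sigma> \<tau> (AllS \<phi>) = AllS (sub (\<lambda>i. wkS_n (\<sigma> i)) (upS \<tau>) \<phi>)"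
| "sub \<sigma> \<tau> (ExS \<phi>) = ExS (sub (\<lambda>i. wkS_n (\<sigma> i)) (upS \<tau>) \<phi>)"

abbreviation instN :: "ntm \<Rightarrow> fm \<Rightarrow> fm"
  where "instN t \<equiv> sub (case_nat t NVar) SVar"

abbreviation instS :: "stm \<Rightarrow> fm \<Rightarrow> fm"
  where "instS a \<equiv> sub NVar (case_nat a SVar)"


section \<open>Notions of intuitionistic analysis\<close>

definition Plus :: "ntm \<Rightarrow> ntm \<Rightarrow> ntm"
  where "Plus t u = Rec t (Succ (NVar 0)) u"

definition Less :: "ntm \<Rightarrow> ntm \<Rightarrow> fm"
  where "Less t u = ExN (Plus (wkN_n t) (Succ (NVar 0)) \<^bold>= wkN_n u)"

text \<open>\<open>snoc s n\<close> is \<open>s*\<langle>n\<rangle>\<close>; \<open>bar a n\<close> is the code of the initial segment of \<open>a\<close> of length \<open>n\<close>;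
  \<open>sect a m\<close> is the sequence \<open>a\<^sup>m = \<lambda>k. a(\<langle>m\<rangle>*k)\<close>.\<close>

definition snoc :: "ntm \<Rightarrow> ntm \<Rightarrow> ntm"
  where "snoc s n = Append s (Cns n Zero)"

definition bar :: "stm \<Rightarrow> ntm \<Rightarrow> ntm"
  where "bar a n = Rec Zero (snoc (NVar 0) (Ap (wkN_s (wkN_s a)) (NVar 1))) n"

definition sect :: "stm \<Rightarrow> ntm \<Rightarrow> stm"
  where "sect a m = Lam (Ap (wkN_s a) (Cns (wkN_n m) (NVar 0)))"

definition zero_seq :: stm
  where "zero_seq = Lam Zero"

definition seq_eq :: "stm \<Rightarrow> stm \<Rightarrow> fm"
  where "seq_eq a b = AllN (Ap (wkN_s a) (NVar 0) \<^bold>= Ap (wkN_s b) (NVar 0))"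

definition apart :: "stm \<Rightarrow> stm \<Rightarrow> fm"
  where "apart a b = ExN (\<^bold>\<not> (Ap (wkN_s a) (NVar 0) \<^bold>= Ap (wkN_s b) (NVar 0)))"

definition spread_law :: "stm \<Rightarrow> fm"
  where "spread_law b =
    AllN ((Ap (wkN_s b) (NVar 0) \<^bold>= Zero) \<^bold>\<longleftrightarrow>
      ExN (Ap (wkN_s (wkN_s b)) (snoc (NVar 1) (NVar 0)) \<^bold>= Zero))"

text \<open>\<open>in_spread b a\<close>: \<open>a\<close> belongs to the spread given by the law \<open>b\<close>.\<close>

definition in_spread :: "stm \<Rightarrow> stm \<Rightarrow> fm"
  where "in_spread b a = AllN (Ap (wkN_s b) (bar (wkN_s a) (NVar 0)) \<^bold>= Zero)"

text \<open>A spread is a fan if every admitted finite sequence has boundedly many admitted immediate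
  extensions.\<close>

definition fan_law :: "stm \<Rightarrow> fm"
  where "fan_law b = (spread_law b \<^bold>\<and>
    AllN ((Ap (wkN_s b) (NVar 0) \<^bold>= Zero) \<^bold>\<longrightarrow>
      ExN (AllN ((Ap (wkN_s (wkN_s (wkN_s b))) (snoc (NVar 2) (NVar 0)) \<^bold>= Zero) \<^bold>\<longrightarrow>
        Less (NVar 0) (NVar 1)))))"

text \<open>\<open>num_value g a p\<close>: the first nonzero value \<open>g(bar a m)\<close>, \<open>m = 0, 1, \<dots>\<close>, exists and equals \<open>p + 1\<close>.
  \<open>fun_value g a c\<close>: \<open>g|a = c\<close>.\<close>

definition num_value :: "stm \<Rightarrow> stm \<Rightarrow> ntm \<Rightarrow> fm"
  where "num_value g a p =
    ExN ((Ap (wkN_s g) (bar (wkN_s a) (NVar 0)) \<^bold>= Succ (wkN_n p)) \<^bold>\<and>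
      AllN (Less (NVar 0) (NVar 1) \<^bold>\<longrightarrow>
        Ap (wkN_s (wkN_s g)) (bar (wkN_s (wkN_s a)) (NVar 0)) \<^bold>= Zero))"

definition fun_value :: "stm \<Rightarrow> stm \<Rightarrow> stm \<Rightarrow> fm"
  where "fun_value g a c =
    AllN (num_value (sect (wkN_s g) (NVar 0)) (wkN_s a) (Ap (wkN_s c) (NVar 0)))"

text \<open>\<open>codes_fun g b\<close>: \<open>g\<close> codes a continuous function from the spread \<open>b\<close> to Baire space. The
  universal spread has the law \<open>zero_seq\<close>.\<close>

definition codes_fun :: "stm \<Rightarrow> stm \<Rightarrow> fm"
  where "codes_fun g b =
    AllN (AllS (in_spread (wkS_s (wkN_s b)) (SVar 0) \<^bold>\<longrightarrow>
      ExN (\<^bold>\<not> (Ap (sect (wkN_s (wkS_s (wkN_s g))) (NVar 1)) (bar (SVar 0) (NVar 0)) \<^bold>= Zero))))"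

definition in_D2A1 :: "stm \<Rightarrow> fm"
  where "in_D2A1 a =
    (seq_eq (sect a Zero) zero_seq \<^bold>\<or> seq_eq (sect a (Succ Zero)) zero_seq)"

text \<open>\<open>{g|a : a \<in> F\<^sub>b} = D\<^sup>2(A\<^sub>1)\<close>, where \<open>F\<^sub>b\<close> is the spread with law \<open>b\<close>.\<close>

definition onto_D2A1 :: "stm \<Rightarrow> stm \<Rightarrow> fm"
  where "onto_D2A1 g b =
    AllS (ExS (in_spread (wkS_s (wkS_s b)) (SVar 0) \<^bold>\<and>
        fun_value (wkS_s (wkS_s g)) (SVar 0) (SVar 1))
      \<^bold>\<longleftrightarrow> in_D2A1 (SVar 0))"


section \<open>The formal theory\<close>

text \<open>In the schemes, \<open>\<phi>\<close> and \<open>\<psi>\<close> are arbitrary formulas, possibly with further free variables of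
  both sorts.\<close>

inductive_set ax :: "fm set"
where
  Refl: "(t \<^bold>= t) \<in> ax"
| Leibniz: "((t \<^bold>= u) \<^bold>\<longrightarrow> instN t \<phi> \<^bold>\<longrightarrow> instN u \<phi>) \<in> ax"
| Succ_nonzero: "(\<^bold>\<not> (Succ t \<^bold>= Zero)) \<in> ax"
| Succ_inject: "((Succ t \<^bold>= Succ u) \<^bold>\<longrightarrow> t \<^bold>= u) \<in> ax"
| Induction: "(instN Zero \<phi> \<^bold>\<and>
    AllN (\<phi> \<^bold>\<longrightarrow> sub (case_nat (Succ (NVar 0)) (\<lambda>i. NVar (Suc i))) SVar \<phi>) \<^bold>\<longrightarrow> AllN \<phi>) \<in> ax"
| Rec_Zero: "(Rec t b Zero \<^bold>= t) \<in> ax"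
| Rec_Succ: "(Rec t b (Succ u) \<^bold>=
    sub_n (case_nat (Rec t b u) (case_nat u NVar)) SVar b) \<in> ax"
| Beta: "(Ap (Lam t) u \<^bold>= sub_n (case_nat u NVar) SVar t) \<in> ax"
| Cns_nonzero: "(\<^bold>\<not> (Cns t u \<^bold>= Zero)) \<in> ax"
| Hd_Cns: "(Hd (Cns t u) \<^bold>= t) \<in> ax"
| Tl_Cns: "(Tl (Cns t u) \<^bold>= u) \<in> ax"
| Cns_exhaust: "((t \<^bold>= Zero) \<^bold>\<or> (t \<^bold>= Cns (Hd t) (Tl t))) \<in> ax"
| Cns_greater_hd: "Less t (Cns t u) \<in> ax"
| Cns_greater_tl: "Less u (Cns t u) \<in> ax"
| Append_Zero: "(Append Zero u \<^bold>= u) \<in> ax"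
| Append_Cns: "(Append (Cns t s) u \<^bold>= Cns t (Append s u)) \<in> ax"
  \<comment> \<open>Countable choice. \<open>AC00\<close>: \<open>\<phi>(m,n)\<close> with \<open>m = NVar 1\<close>, \<open>n = NVar 0\<close>;
    from \<open>\<forall>m \<exists>n \<phi>(m,n)\<close> infer \<open>\<exists>\<alpha> \<forall>m \<phi>(m,\<alpha>(m))\<close>.
    \<open>AC01\<close>: \<open>\<phi>(m,\<alpha>)\<close> with \<open>m = NVar 0\<close>, \<open>\<alpha> = SVar 0\<close>;
    from \<open>\<forall>m \<exists>\<alpha> \<phi>(m,\<alpha>)\<close> infer \<open>\<exists>\<alpha> \<forall>m \<phi>(m,\<alpha>\<^sup>m)\<close>.\<close>
| AC00: "(AllN (ExN \<phi>) \<^bold>\<longrightarrow>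
    ExS (AllN (sub (case_nat (Ap (SVar 0) (NVar 0)) NVar) (\<lambda>i. SVar (Suc i)) \<phi>))) \<in> ax"
| AC01: "(AllN (ExS \<phi>) \<^bold>\<longrightarrow>
    ExS (AllN (sub NVar (case_nat (sect (SVar 0) (NVar 0)) (\<lambda>i. SVar (Suc i))) \<phi>))) \<in> ax"
  \<comment> \<open>Brouwer's Continuity Principle for a spread \<open>F\<close> with law \<open>b\<close> (\<open>b = zero_seq\<close>: Baire space);
    \<open>\<phi>(\<alpha>,n)\<close> with \<open>\<alpha> = SVar 0\<close>, \<open>n = NVar 0\<close>. From \<open>\<forall>\<alpha>\<in>F \<exists>n \<phi>(\<alpha>,n)\<close> infer
    \<open>\<forall>\<alpha>\<in>F \<exists>m \<exists>n \<forall>\<beta>\<in>F (bar \<beta> m = bar \<alpha> m \<longrightarrow> \<phi>(\<beta>,n))\<close>.\<close>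
| BCP: "(spread_law b \<^bold>\<longrightarrow>
    AllS (in_spread (wkS_s b) (SVar 0) \<^bold>\<longrightarrow> ExN \<phi>) \<^bold>\<longrightarrow>
    AllS (in_spread (wkS_s b) (SVar 0) \<^bold>\<longrightarrow>
      ExN (ExN (AllS (in_spread (wkS_s (wkS_s (wkN_s (wkN_s b)))) (SVar 0) \<^bold>\<longrightarrow>
        (bar (SVar 0) (NVar 1) \<^bold>= bar (SVar 1) (NVar 1)) \<^bold>\<longrightarrow>
        ren (up Suc) (up Suc) \<phi>))))) \<in> ax"
  \<comment> \<open>Continuous choice. \<open>AC10\<close>: \<open>\<phi>(\<alpha>,n)\<close> with \<open>\<alpha> = SVar 0\<close>, \<open>n = NVar 0\<close>.
    \<open>AC11\<close>: \<open>\<phi>(\<alpha>,\<beta>)\<close> with \<open>\<alpha> = SVar 1\<close>, \<open>\<beta> = SVar 0\<close>.\<close>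
| AC10: "(AllS (ExN \<phi>) \<^bold>\<longrightarrow>
    ExS (AllS (ExN (\<^bold>\<not> (Ap (SVar 1) (bar (SVar 0) (NVar 0)) \<^bold>= Zero))) \<^bold>\<and>
      AllS (ExN (num_value (SVar 1) (SVar 0) (NVar 0) \<^bold>\<and>
        ren id (up Suc) \<phi>)))) \<in> ax"
| AC11: "(AllS (ExS \<phi>) \<^bold>\<longrightarrow>
    ExS (codes_fun (SVar 0) zero_seq \<^bold>\<and>
      AllS (ExS (fun_value (SVar 2) (SVar 1) (SVar 0) \<^bold>\<and>
        ren id (up (up Suc)) \<phi>)))) \<in> ax"
  \<comment> \<open>Thesis on Bars, as the principle of bar induction: if \<open>B\<close> (given by \<open>\<phi>\<close>) is a bar in Baire
    space, \<open>B \<subseteq> C\<close> (given by \<open>\<psi>\<close>), and \<open>C\<close> is monotone and inductive, then \<open>\<langle>\<rangle> \<in> C\<close>.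
    The finite sequence is \<open>NVar 0\<close> in \<open>\<phi>\<close> and \<open>\<psi>\<close>.\<close>
| Thesis_on_Bars: "(AllS (ExN (sub (case_nat (bar (SVar 0) (NVar 0)) (\<lambda>i. NVar (Suc i)))
        (\<lambda>i. SVar (Suc i)) \<phi>)) \<^bold>\<longrightarrow>
    AllN (\<phi> \<^bold>\<longrightarrow> \<psi>) \<^bold>\<longrightarrow>
    AllN (\<psi> \<^bold>\<longleftrightarrow>
      AllN (sub (case_nat (snoc (NVar 1) (NVar 0)) (\<lambda>i. NVar (Suc (Suc i)))) SVar \<psi>)) \<^bold>\<longrightarrow>
    instN Zero \<psi>) \<in> ax"
  \<comment> \<open>Fan Theorem for a fan \<open>F\<close> with law \<open>b\<close>: if \<open>\<forall>\<alpha>\<in>F \<exists>n \<phi>(bar \<alpha> n)\<close>, then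
    \<open>\<exists>m \<forall>\<alpha>\<in>F \<exists>n<m \<phi>(bar \<alpha> n)\<close>. The finite sequence is \<open>NVar 0\<close> in \<open>\<phi>\<close>.\<close>
| Fan: "(fan_law b \<^bold>\<longrightarrow>
    AllS (in_spread (wkS_s b) (SVar 0) \<^bold>\<longrightarrow>
      ExN (sub (case_nat (bar (SVar 0) (NVar 0)) (\<lambda>i. NVar (Suc i)))
        (\<lambda>i. SVar (Suc i)) \<phi>)) \<^bold>\<longrightarrow>
    ExN (AllS (in_spread (wkS_s (wkN_s b)) (SVar 0) \<^bold>\<longrightarrow>
      ExN (Less (NVar 0) (NVar 1) \<^bold>\<and>
        sub (case_nat (bar (SVar 0) (NVar 0)) (\<lambda>i. NVar (Suc (Suc i))))
          (\<lambda>i. SVar (Suc i)) \<phi>)))) \<in> ax"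

text \<open>Natural deduction for two-sorted intuitionistic predicate logic over the axioms \<open>ax\<close>.\<close>

inductive derivable :: "fm set \<Rightarrow> fm \<Rightarrow> bool"  (infix \<open>\<turnstile>\<close> 20)
where
  Ax: "\<phi> \<in> ax \<Longrightarrow> \<Gamma> \<turnstile> \<phi>"
| Assm: "\<phi> \<in> \<Gamma> \<Longrightarrow> \<Gamma> \<turnstile> \<phi>"
| FlsE: "\<Gamma> \<turnstile> Fls \<Longrightarrow> \<Gamma> \<turnstile> \<phi>"
| AndI: "\<Gamma> \<turnstile> \<phi> \<Longrightarrow> \<Gamma> \<turnstile> \<psi> \<Longrightarrow> \<Gamma> \<turnstile> \<phi> \<^bold>\<and> \<psi>"
| AndE1: "\<Gamma> \<turnstile> \<phi> \<^bold>\<and> \<psi> \<Longrightarrow> \<Gamma> \<turnstile> \<phi>"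
| AndE2: "\<Gamma> \<turnstile> \<phi> \<^bold>\<and> \<psi> \<Longrightarrow> \<Gamma> \<turnstile> \<psi>"
| OrI1: "\<Gamma> \<turnstile> \<phi> \<Longrightarrow> \<Gamma> \<turnstile> \<phi> \<^bold>\<or> \<psi>"
| OrI2: "\<Gamma> \<turnstile> \<psi> \<Longrightarrow> \<Gamma> \<turnstile> \<phi> \<^bold>\<or> \<psi>"
| OrE: "\<Gamma> \<turnstile> \<phi> \<^bold>\<or> \<psi> \<Longrightarrow> insert \<phi> \<Gamma> \<turnstile> \<chi> \<Longrightarrow> insert \<psi> \<Gamma> \<turnstile> \<chi> \<Longrightarrow> \<Gamma> \<turnstile> \<chi>"
| ImpI: "insert \<phi> \<Gamma> \<turnstile> \<psi> \<Longrightarrow> \<Gamma> \<turnstile> \<phi> \<^bold>\<longrightarrow> \<psi>"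
| ImpE: "\<Gamma> \<turnstile> \<phi> \<^bold>\<longrightarrow> \<psi> \<Longrightarrow> \<Gamma> \<turnstile> \<phi> \<Longrightarrow> \<Gamma> \<turnstile> \<psi>"
| AllNI: "wkN ` \<Gamma> \<turnstile> \<phi> \<Longrightarrow> \<Gamma> \<turnstile> AllN \<phi>"
| AllNE: "\<Gamma> \<turnstile> AllN \<phi> \<Longrightarrow> \<Gamma> \<turnstile> instN t \<phi>"
| ExNI: "\<Gamma> \<turnstile> instN t \<phi> \<Longrightarrow> \<Gamma> \<turnstile> ExN \<phi>"
| ExNE: "\<Gamma> \<turnstile> ExN \<phi> \<Longrightarrow> insert \<phi> (wkN ` \<Gamma>) \<turnstile> wkN \<chi> \<Longrightarrow> \<Gamma> \<turnstile> \<chi>"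
| AllSI: "wkS ` \<Gamma> \<turnstile> \<phi> \<Longrightarrow> \<Gamma> \<turnstile> AllS \<phi>"
| AllSE: "\<Gamma> \<turnstile> AllS \<phi> \<Longrightarrow> \<Gamma> \<turnstile> instS a \<phi>"
| ExSI: "\<Gamma> \<turnstile> instS a \<phi> \<Longrightarrow> \<Gamma> \<turnstile> ExS \<phi>"
| ExSE: "\<Gamma> \<turnstile> ExS \<phi> \<Longrightarrow> insert \<phi> (wkS ` \<Gamma>) \<turnstile> wkS \<chi> \<Longrightarrow> \<Gamma> \<turnstile> \<chi>"

end

theory Submission
  imports Defs "HOL-Library.FSet"
begin

text \<open>
  Let \<open>g\<close> map the spread \<open>F\<close> onto \<open>D\<^sup>2(A\<^sub>1)\<close>, and let \<open>a \<in> F\<close> with \<open>g|a = 0\<close>. Every value of \<open>g\<close> has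
  its section 0 or its section 1 equal to zero, so the Continuity Principle on \<open>F\<close> gives one \<open>i\<close>
  and an \<open>m\<close> such that \<open>(g|c)\<^sup>i = 0\<close> for every \<open>c \<in> F\<close> agreeing with \<open>a\<close> up to \<open>m\<close>. On the other
  hand every \<open>d\<close> gives an element of \<open>D\<^sup>2(A\<^sub>1)\<close> with section \<open>i\<close> equal to \<open>d\<close>, which has a preimage
  in \<open>F\<close>. By the Continuity Principle on Baire space, the initial segment of length \<open>m\<close> of the
  preimage can be chosen to be one and the same \<open>s\<close> for all \<open>d\<close> near zero. Some of these \<open>d\<close> are
  apart from zero, so \<open>s\<close> is not the initial segment of \<open>a\<close>. The preimage of zero with initial
  segment \<open>s\<close> is therefore apart from \<open>a\<close>, and both are mapped to zero.
\<close>

section \<open>Substitution\<close>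

text \<open>Lets the simplifier rewrite the branches of \<open>up\<close> and \<open>upN\<close>.\<close>

declare nat.case_cong_weak [cong del]

lemma up_up: "up r (up r' i) = up (\<lambda>i. r (r' i)) i"
  by (simp split: nat.split)

lemma ren_ren_tm:
  "ren_n r q (ren_n r' q' t) = ren_n (\<lambda>i. r (r' i)) (\<lambda>i. q (q' i)) t"
  "ren_s r q (ren_s r' q' a) = ren_s (\<lambda>i. r (r' i)) (\<lambda>i. q (q' i)) a"
  by (induction t and a arbitrary: r q r' q' and r q r' q') (simp_all add: up_up)

lemma upN_up: "upN \<sigma> (up r i) = upN (\<lambda>i. \<sigma> (r i)) i"
  by (simp split: nat.split)

lemma sub_ren_tm:
  "sub_n \<sigma> \<tau> (ren_n r q t) = sub_n (\<lambda>i. \<sigma> (r i)) (\<lambda>i. \<tau> (q i)) t"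
  "sub_s \<sigma> \<tau> (ren_s r q a) = sub_s (\<lambda>i. \<sigma> (r i)) (\<lambda>i. \<tau> (q i)) a"
  by (induction t and a arbitrary: \<sigma> \<tau> r q and \<sigma> \<tau> r q) (simp_all add: upN_up)

lemma ren_upN: "ren_n (up r) q (upN \<sigma> i) = upN (\<lambda>i. ren_n r q (\<sigma> i)) i"
  by (simp split: nat.split add: ren_ren_tm)

lemma ren_sub_tm:
  "ren_n r q (sub_n \<sigma> \<tau> t) = sub_n (\<lambda>i. ren_n r q (\<sigma> i)) (\<lambda>i. ren_s r q (\<tau> i)) t"
  "ren_s r q (sub_s \<sigma> \<tau> a) = sub_s (\<lambda>i. ren_n r q (\<sigma> i)) (\<lambda>i. ren_s r q (\<tau> i)) a"
  by (induction t and a arbitrary: \<sigma> \<tau> r q and \<sigma> \<tau> r q) (simp_all add: ren_upN ren_ren_tm)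

lemma sub_upN: "sub_n (upN \<sigma>) (\<lambda>i. wkN_s (\<tau> i)) (upN \<sigma>' i) = upN (\<lambda>i. sub_n \<sigma> \<tau> (\<sigma>' i)) i"
  by (simp split: nat.split add: sub_ren_tm ren_sub_tm)

lemma sub_upS: "sub_s (\<lambda>i. wkS_n (\<sigma> i)) (upS \<tau>) (upS \<tau>' i) = upS (\<lambda>i. sub_s \<sigma> \<tau> (\<tau>' i)) i"
  by (simp split: nat.split add: sub_ren_tm ren_sub_tm)

lemma sub_upN_upN:
  "sub_n (upN (upN \<sigma>)) (\<lambda>i. wkN_s (wkN_s (\<tau> i))) (upN (upN \<sigma>') i) =
    upN (upN (\<lambda>i. sub_n \<sigma> \<tau> (\<sigma>' i))) i"
  by (simp only: sub_upN[of "upN \<sigma>" "\<lambda>i. wkN_s (\<tau> i)"] sub_upN)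

lemma sub_sub_tm:
  "sub_n \<sigma> \<tau> (sub_n \<sigma>' \<tau>' t) = sub_n (\<lambda>i. sub_n \<sigma> \<tau> (\<sigma>' i)) (\<lambda>i. sub_s \<sigma> \<tau> (\<tau>' i)) t"
  "sub_s \<sigma> \<tau> (sub_s \<sigma>' \<tau>' a) = sub_s (\<lambda>i. sub_n \<sigma> \<tau> (\<sigma>' i)) (\<lambda>i. sub_s \<sigma> \<tau> (\<tau>' i)) a"
proof (induction t and a arbitrary: \<sigma> \<tau> \<sigma>' \<tau>' and \<sigma> \<tau> \<sigma>' \<tau>')
  case (Rec t u v)
  then show ?case by (simp add: sub_upN_upN sub_ren_tm(2) ren_sub_tm(2) del: nat.case) simp
qed (simp_all add: sub_upN sub_ren_tm ren_sub_tm)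

lemma sub_sub:
  "sub \<sigma> \<tau> (sub \<sigma>' \<tau>' \<phi>) = sub (\<lambda>i. sub_n \<sigma> \<tau> (\<sigma>' i)) (\<lambda>i. sub_s \<sigma> \<tau> (\<tau>' i)) \<phi>"
  by (induction \<phi> arbitrary: \<sigma> \<tau> \<sigma>' \<tau>')
    (simp_all add: sub_sub_tm sub_upN sub_upS sub_ren_tm ren_sub_tm)

lemma case_nat_NVar: "case_nat (NVar 0) (\<lambda>i. NVar (r i)) = (\<lambda>i. NVar (case_nat 0 r i))"
  by (auto split: nat.split)

lemma case_nat_SVar: "case_nat (SVar 0) (\<lambda>i. SVar (q i)) = (\<lambda>i. SVar (case_nat 0 q i))"
  by (auto split: nat.split)

lemma ren_tm_eq_sub:
  "ren_n r q t = sub_n (\<lambda>i. NVar (r i)) (\<lambda>i. SVar (q i)) t"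
  "ren_s r q a = sub_s (\<lambda>i. NVar (r i)) (\<lambda>i. SVar (q i)) a"
  by (induction t and a arbitrary: r q and r q) (simp_all add: case_nat_NVar)

lemma ren_eq_sub: "ren r q \<phi> = sub (\<lambda>i. NVar (r i)) (\<lambda>i. SVar (q i)) \<phi>"
  by (induction \<phi> arbitrary: r q)
    (simp_all add: case_nat_NVar case_nat_SVar ren_tm_eq_sub[symmetric])

lemma case_nat_Suc: "case_nat 0 Suc = (\<lambda>i. i)"
  by (auto split: nat.split)

lemma sub_id_tm: "sub_n NVar SVar t = t" "sub_s NVar SVar a = a"
  by (induction t and a) (simp_all add: case_nat_NVar case_nat_Suc)

lemma sub_id: "sub NVar SVar \<phi> = \<phi>"
  by (induction \<phi>) (simp_all add: sub_id_tm case_nat_NVar case_nat_SVar case_nat_Suc)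

text \<open>Once all maps are moved into the branches, equal substitutions have equal normal forms.\<close>

lemma case_nat_apply:
  "NVar (case_nat r q i) = case_nat (NVar r) (\<lambda>i. NVar (q i)) i"
  "SVar (case_nat r q i) = case_nat (SVar r) (\<lambda>i. SVar (q i)) i"
  "sub_n \<sigma> \<tau> (case_nat t f i) = case_nat (sub_n \<sigma> \<tau> t) (\<lambda>i. sub_n \<sigma> \<tau> (f i)) i"
  "sub_s \<sigma> \<tau> (case_nat a g i) = case_nat (sub_s \<sigma> \<tau> a) (\<lambda>i. sub_s \<sigma> \<tau> (g i)) i"
  "Suc (case_nat r q i) = case_nat (Suc r) (\<lambda>i. Suc (q i)) i"
  by (simp_all split: nat.split)

lemma case_nat_eta:
  "case_nat (NVar 0) (\<lambda>i. NVar (Suc i)) = NVar"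
  "case_nat (SVar 0) (\<lambda>i. SVar (Suc i)) = SVar"
  "case_nat (NVar (Suc 0)) (\<lambda>i. NVar (Suc (Suc i))) = (\<lambda>i. NVar (Suc i))"
  by (auto split: nat.split)

lemmas sub_normalize [simp] = ren_tm_eq_sub ren_eq_sub sub_sub_tm sub_sub sub_id_tm sub_id
  case_nat_apply case_nat_eta

declare numeral_2_eq_2 [simp] numeral_3_eq_3 [simp]

lemma sub_Plus [simp]: "sub_n \<sigma> \<tau> (Plus t u) = Plus (sub_n \<sigma> \<tau> t) (sub_n \<sigma> \<tau> u)"
  by (simp add: Plus_def)

lemma sub_snoc [simp]: "sub_n \<sigma> \<tau> (snoc t u) = snoc (sub_n \<sigma> \<tau> t) (sub_n \<sigma> \<tau> u)"
  by (simp add: snoc_def)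

lemma sub_bar [simp]: "sub_n \<sigma> \<tau> (bar a u) = bar (sub_s \<sigma> \<tau> a) (sub_n \<sigma> \<tau> u)"
  by (simp add: bar_def)

lemma sub_sect [simp]: "sub_s \<sigma> \<tau> (sect a u) = sect (sub_s \<sigma> \<tau> a) (sub_n \<sigma> \<tau> u)"
  by (simp add: sect_def)

lemma sub_zero_seq [simp]: "sub_s \<sigma> \<tau> zero_seq = zero_seq"
  by (simp add: zero_seq_def)

lemma sub_Less [simp]: "sub \<sigma> \<tau> (Less t u) = Less (sub_n \<sigma> \<tau> t) (sub_n \<sigma> \<tau> u)"
  by (simp add: Less_def)

lemma sub_Neg [simp]: "sub \<sigma> \<tau> (\<^bold>\<not> \<phi>) = (\<^bold>\<not> sub \<sigma> \<tau> \<phi>)"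
  by (simp add: Neg_def)

lemma sub_Iff [simp]: "sub \<sigma> \<tau> (\<phi> \<^bold>\<longleftrightarrow> \<psi>) = (sub \<sigma> \<tau> \<phi> \<^bold>\<longleftrightarrow> sub \<sigma> \<tau> \<psi>)"
  by (simp add: Iff_def)

lemma sub_seq_eq [simp]: "sub \<sigma> \<tau> (seq_eq a b) = seq_eq (sub_s \<sigma> \<tau> a) (sub_s \<sigma> \<tau> b)"
  by (simp add: seq_eq_def)

lemma sub_apart [simp]: "sub \<sigma> \<tau> (apart a b) = apart (sub_s \<sigma> \<tau> a) (sub_s \<sigma> \<tau> b)"
  by (simp add: apart_def)

lemma sub_spread_law [simp]: "sub \<sigma> \<tau> (spread_law a) = spread_law (sub_s \<sigma> \<tau> a)"
  by (simp add: spread_law_def)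

lemma sub_fan_law [simp]: "sub \<sigma> \<tau> (fan_law a) = fan_law (sub_s \<sigma> \<tau> a)"
  by (simp add: fan_law_def)

lemma sub_in_spread [simp]: "sub \<sigma> \<tau> (in_spread b a) = in_spread (sub_s \<sigma> \<tau> b) (sub_s \<sigma> \<tau> a)"
  by (simp add: in_spread_def)

lemma sub_num_value [simp]:
  "sub \<sigma> \<tau> (num_value g a p) = num_value (sub_s \<sigma> \<tau> g) (sub_s \<sigma> \<tau> a) (sub_n \<sigma> \<tau> p)"
  by (simp add: num_value_def)

lemma sub_fun_value [simp]:
  "sub \<sigma> \<tau> (fun_value g a c) = fun_value (sub_s \<sigma> \<tau> g) (sub_s \<sigma> \<tau> a) (sub_s \<sigma> \<tau> c)"
  by (simp add: fun_value_def)

lemma sub_codes_fun [simp]: "sub \<sigma> \<tau> (codes_fun g b) = codes_fun (sub_s \<sigma> \<tau> g) (sub_s \<sigma> \<tau> b)"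
  by (simp add: codes_fun_def)

lemma sub_in_D2A1 [simp]: "sub \<sigma> \<tau> (in_D2A1 a) = in_D2A1 (sub_s \<sigma> \<tau> a)"
  by (simp add: in_D2A1_def)

lemma sub_onto_D2A1 [simp]: "sub \<sigma> \<tau> (onto_D2A1 g b) = onto_D2A1 (sub_s \<sigma> \<tau> g) (sub_s \<sigma> \<tau> b)"
  by (simp add: onto_D2A1_def)

lemma sub_ax: "\<phi> \<in> ax \<Longrightarrow> sub \<sigma> \<tau> \<phi> \<in> ax"
proof (induction rule: ax.induct)
  case (Leibniz t u \<phi>)
  from ax.Leibniz[of "sub_n \<sigma> \<tau> t" "sub_n \<sigma> \<tau> u" "sub (upN \<sigma>) (\<lambda>i. wkN_s (\<tau> i)) \<phi>"]
  show ?case by simp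
next
  case (Induction \<phi>)
  from ax.Induction[of "sub (upN \<sigma>) (\<lambda>i. wkN_s (\<tau> i)) \<phi>"] show ?case by simp
next
  case (Rec_Succ t b u)
  from ax.Rec_Succ[of "sub_n \<sigma> \<tau> t" "sub_n (upN (upN \<sigma>)) (\<lambda>i. wkN_s (wkN_s (\<tau> i))) b"
      "sub_n \<sigma> \<tau> u"] show ?case by simp
next
  case (Beta t u)
  from ax.Beta[of "sub_n (upN \<sigma>) (\<lambda>i. wkN_s (\<tau> i)) t" "sub_n \<sigma> \<tau> u"] show ?case by simp
next
  case (AC00 \<phi>)
  from ax.AC00[of "sub (upN (upN \<sigma>)) (\<lambda>i. wkN_s (wkN_s (\<tau> i))) \<phi>"] show ?case by simp
next
  case (AC01 \<phi>)
  from ax.AC01[of "sub (\<lambda>i. wkS_n (upN \<sigma> i)) (upS (\<lambda>i. wkN_s (\<tau> i))) \<phi>"] show ?case by simp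
next
  case (BCP b \<phi>)
  from ax.BCP[of "sub_s \<sigma> \<tau> b" "sub (upN (\<lambda>i. wkS_n (\<sigma> i))) (\<lambda>i. wkN_s (upS \<tau> i)) \<phi>"]
  show ?case by simp
next
  case (AC10 \<phi>)
  from ax.AC10[of "sub (upN (\<lambda>i. wkS_n (\<sigma> i))) (\<lambda>i. wkN_s (upS \<tau> i)) \<phi>"] show ?case by simp
next
  case (AC11 \<phi>)
  from ax.AC11[of "sub (\<lambda>i. wkS_n (wkS_n (\<sigma> i))) (upS (upS \<tau>)) \<phi>"] show ?case by simp
next
  case (Thesis_on_Bars \<phi> \<psi>)
  from ax.Thesis_on_Bars[of "sub (upN \<sigma>) (\<lambda>i. wkN_s (\<tau> i)) \<phi>" "sub (upN \<sigma>) (\<lambda>i. wkN_s (\<tau> i)) \<psi>"]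
  show ?case by simp
next
  case (Fan b \<phi>)
  from ax.Fan[of "sub_s \<sigma> \<tau> b" "sub (upN \<sigma>) (\<lambda>i. wkN_s (\<tau> i)) \<phi>"] show ?case by simp
qed (simp, rule ax.intros)+

section \<open>Natural deduction in finite contexts\<close>

lemma derivable_mono: "\<Gamma> \<turnstile> \<phi> \<Longrightarrow> \<Gamma> \<subseteq> \<Delta> \<Longrightarrow> \<Delta> \<turnstile> \<phi>"
proof (induction arbitrary: \<Delta> rule: derivable.induct)
  case (OrE \<Gamma> \<phi> \<psi> \<chi>)
  then show ?case by (meson derivable.OrE insert_mono)
next
  case (ImpI \<phi> \<Gamma> \<psi>)
  then show ?case by (meson derivable.ImpI insert_mono)
next
  case (AllNI \<Gamma> \<phi>)
  then show ?case by (meson derivable.AllNI image_mono)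
next
  case (ExNE \<Gamma> \<phi> \<chi>)
  then show ?case by (meson derivable.ExNE insert_mono image_mono)
next
  case (AllSI \<Gamma> \<phi>)
  then show ?case by (meson derivable.AllSI image_mono)
next
  case (ExSE \<Gamma> \<phi> \<chi>)
  then show ?case by (meson derivable.ExSE insert_mono image_mono)
qed (meson derivable.intros subsetD)+

lemma derivable_sub: "\<Gamma> \<turnstile> \<phi> \<Longrightarrow> sub \<sigma> \<tau> ` \<Gamma> \<turnstile> sub \<sigma> \<tau> \<phi>"
proof (induction arbitrary: \<sigma> \<tau> rule: derivable.induct)
  case (Ax \<phi> \<Gamma>)
  then show ?case by (intro derivable.Ax sub_ax)
next
  case (OrE \<Gamma> \<phi> \<psi> \<chi>)
  from derivable.OrE[OF OrE.IH(1)[unfolded sub.simps]] OrE.IH(2,3) show ?case by simp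
next
  case (ImpE \<Gamma> \<phi> \<psi>)
  from derivable.ImpE[OF ImpE.IH(1)[unfolded sub.simps] ImpE.IH(2)] show ?case .
next
  case (AllNI \<Gamma> \<phi>)
  from AllNI.IH[of "upN \<sigma>" "\<lambda>i. wkN_s (\<tau> i)"] show ?case
    by (auto intro!: derivable.AllNI simp: image_image)
next
  case (AllNE \<Gamma> \<phi> t)
  from derivable.AllNE[OF AllNE.IH[unfolded sub.simps], of \<sigma> \<tau> "sub_n \<sigma> \<tau> t"] show ?case by simp
next
  case (ExNI \<Gamma> t \<phi>)
  from ExNI.IH[of \<sigma> \<tau>] show ?case by (auto intro!: derivable.ExNI[of _ "sub_n \<sigma> \<tau> t"])
next
  case (ExNE \<Gamma> \<phi> \<chi>)
  from ExNE.IH(1)[of \<sigma> \<tau>] ExNE.IH(2)[of "upN \<sigma>" "\<lambda>i. wkN_s (\<tau> i)"] show ?case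
    by (auto intro: derivable.ExNE simp: image_image)
next
  case (AllSI \<Gamma> \<phi>)
  from AllSI.IH[of "\<lambda>i. wkS_n (\<sigma> i)" "upS \<tau>"] show ?case
    by (auto intro!: derivable.AllSI simp: image_image)
next
  case (AllSE \<Gamma> \<phi> a)
  from derivable.AllSE[OF AllSE.IH[unfolded sub.simps], of \<sigma> \<tau> "sub_s \<sigma> \<tau> a"] show ?case by simp
next
  case (ExSI \<Gamma> a \<phi>)
  from ExSI.IH[of \<sigma> \<tau>] show ?case by (auto intro!: derivable.ExSI[of _ "sub_s \<sigma> \<tau> a"])
next
  case (ExSE \<Gamma> \<phi> \<chi>)
  from ExSE.IH(1)[of \<sigma> \<tau>] ExSE.IH(2)[of "\<lambda>i. wkS_n (\<sigma> i)" "upS \<tau>"] show ?case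
    by (auto intro: derivable.ExSE simp: image_image)
qed (auto intro: derivable.intros)

text \<open>An upper bound for the free variables of both sorts. Bound variables are counted as well, with
  their indices unshifted.\<close>

primrec var_bound_n :: "ntm \<Rightarrow> nat" and var_bound_s :: "stm \<Rightarrow> nat"
where
  "var_bound_n (NVar i) = Suc i"
| "var_bound_n Zero = 0"
| "var_bound_n (Succ t) = var_bound_n t"
| "var_bound_n (Cns t u) = max (var_bound_n t) (var_bound_n u)"
| "var_bound_n (Hd t) = var_bound_n t"
| "var_bound_n (Tl t) = var_bound_n t"
| "var_bound_n (Append t u) = max (var_bound_n t) (var_bound_n u)"
| "var_bound_n (Rec a b n) = max (var_bound_n a) (max (var_bound_n b) (var_bound_n n))"
| "var_bound_n (Ap a t) = max (var_bound_s a) (var_bound_n t)"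
| "var_bound_s (SVar i) = Suc i"
| "var_bound_s (Lam t) = var_bound_n t"

primrec var_bound :: "fm \<Rightarrow> nat"
where
  "var_bound (t \<^bold>= u) = max (var_bound_n t) (var_bound_n u)"
| "var_bound Fls = 0"
| "var_bound (\<phi> \<^bold>\<and> \<psi>) = max (var_bound \<phi>) (var_bound \<psi>)"
| "var_bound (\<phi> \<^bold>\<or> \<psi>) = max (var_bound \<phi>) (var_bound \<psi>)"
| "var_bound (\<phi> \<^bold>\<longrightarrow> \<psi>) = max (var_bound \<phi>) (var_bound \<psi>)"
| "var_bound (AllN \<phi>) = var_bound \<phi>"
| "var_bound (ExN \<phi>) = var_bound \<phi>"
| "var_bound (AllS \<phi>) = var_bound \<phi>"
| "var_bound (ExS \<phi>) = var_bound \<phi>"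

lemma sub_cong_below_tm:
  "\<forall>i<var_bound_n t. \<sigma> i = \<sigma>' i \<and> \<tau> i = \<tau>' i \<Longrightarrow> sub_n \<sigma> \<tau> t = sub_n \<sigma>' \<tau>' t"
  "\<forall>i<var_bound_s a. \<sigma> i = \<sigma>' i \<and> \<tau> i = \<tau>' i \<Longrightarrow> sub_s \<sigma> \<tau> a = sub_s \<sigma>' \<tau>' a"
  by (induction t and a arbitrary: \<sigma> \<sigma>' \<tau> \<tau>' and \<sigma> \<sigma>' \<tau> \<tau>') (simp_all split: nat.split)

lemma sub_cong_below:
  "\<forall>i<var_bound \<phi>. \<sigma> i = \<sigma>' i \<and> \<tau> i = \<tau>' i \<Longrightarrow> sub \<sigma> \<tau> \<phi> = sub \<sigma>' \<tau>' \<phi>"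
proof (induction \<phi> arbitrary: \<sigma> \<sigma>' \<tau> \<tau>')
  case (Eq t u)
  then show ?case
    using sub_cong_below_tm(1)[of t \<sigma> \<sigma>' \<tau> \<tau>'] sub_cong_below_tm(1)[of u \<sigma> \<sigma>' \<tau> \<tau>'] by simp
qed (simp_all split: nat.split)

lemma common_var_bound:
  assumes "finite S"
  obtains N where "\<And>\<phi>. \<phi> \<in> S \<Longrightarrow> var_bound \<phi> \<le> N"
  using assms finite_nat_set_iff_bounded_le[of "var_bound ` S"] by auto

lemma eigenvariable_N:
  assumes "finite S"
  shows "\<exists>x \<sigma>. (\<forall>\<psi>\<in>S. sub \<sigma> SVar \<psi> = wkN \<psi>) \<and> sub \<sigma> SVar (instN (NVar x) \<phi>) = \<phi>"
proof -
  obtain x where x: "\<And>\<psi>. \<psi> \<in> insert \<phi> S \<Longrightarrow> var_bound \<psi> \<le> x"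
    using common_var_bound[of "insert \<phi> S"] assms by blast
  let ?\<sigma> = "\<lambda>i. if i = x then NVar 0 else NVar (Suc i)"
  have "sub ?\<sigma> SVar \<psi> = wkN \<psi>" if "\<psi> \<in> S" for \<psi>
    using x[of \<psi>] that by (auto intro: sub_cong_below)
  moreover have "sub ?\<sigma> SVar (instN (NVar x) \<phi>) = sub NVar SVar \<phi>"
    unfolding sub_sub by (rule sub_cong_below) (use x[of \<phi>] in \<open>auto split: nat.split\<close>)
  ultimately show ?thesis unfolding sub_id by blast
qed

lemma eigenvariable_S:
  assumes "finite S"
  shows "\<exists>x \<tau>. (\<forall>\<psi>\<in>S. sub NVar \<tau> \<psi> = wkS \<psi>) \<and> sub NVar \<tau> (instS (SVar x) \<phi>) = \<phi>"
proof -
  obtain x where x: "\<And>\<psi>. \<psi> \<in> insert \<phi> S \<Longrightarrow> var_bound \<psi> \<le> x"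
    using common_var_bound[of "insert \<phi> S"] assms by blast
  let ?\<tau> = "\<lambda>i. if i = x then SVar 0 else SVar (Suc i)"
  have "sub NVar ?\<tau> \<psi> = wkS \<psi>" if "\<psi> \<in> S" for \<psi>
    using x[of \<psi>] that by (auto intro: sub_cong_below)
  moreover have "sub NVar ?\<tau> (instS (SVar x) \<phi>) = sub NVar SVar \<phi>"
    unfolding sub_sub by (rule sub_cong_below) (use x[of \<phi>] in \<open>auto split: nat.split\<close>)
  ultimately show ?thesis unfolding sub_id by blast
qed

abbreviation derives :: "fm fset \<Rightarrow> fm \<Rightarrow> bool"  (infix \<open>\<tturnstile>\<close> 20)
  where "\<Gamma> \<tturnstile> \<phi> \<equiv> fset \<Gamma> \<turnstile> \<phi>"

lemma weaken: "\<Gamma> \<tturnstile> \<phi> \<Longrightarrow> \<Gamma> |\<subseteq>| \<Delta> \<Longrightarrow> \<Delta> \<tturnstile> \<phi>"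
  by (rule derivable_mono) (simp_all add: less_eq_fset.rep_eq)

text \<open>A finite context leaves a variable of each sort unused, and derivability is closed under
  substitution. This is why rules for \<open>\<tturnstile>\<close> can quantify over all terms instead of introducing an
  eigenvariable that shifts the context. Likewise they quantify over all extensions of the context
  instead of adding a formula to it.\<close>

lemma discharge:
  assumes "\<And>\<Delta>. \<Gamma> |\<subseteq>| \<Delta> \<Longrightarrow> \<Delta> \<tturnstile> \<phi> \<Longrightarrow> \<Delta> \<tturnstile> \<psi>"
  shows "insert \<phi> (fset \<Gamma>) \<turnstile> \<psi>"
proof -
  have "finsert \<phi> \<Gamma> \<tturnstile> \<psi>" by (rule assms) (auto intro: Assm)
  then show ?thesis by simp
qed

lemma Imp_intro: "(\<And>\<Delta>. \<Gamma> |\<subseteq>| \<Delta> \<Longrightarrow> \<Delta> \<tturnstile> \<phi> \<Longrightarrow> \<Delta> \<tturnstile> \<psi>) \<Longrightarrow> \<Gamma> \<tturnstile> \<phi> \<^bold>\<longrightarrow> \<psi>"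
  by (rule ImpI[OF discharge])

lemma Or_elim:
  assumes "\<Gamma> \<tturnstile> \<phi> \<^bold>\<or> \<psi>"
    and "\<And>\<Delta>. \<Gamma> |\<subseteq>| \<Delta> \<Longrightarrow> \<Delta> \<tturnstile> \<phi> \<Longrightarrow> \<Delta> \<tturnstile> \<chi>" and "\<And>\<Delta>. \<Gamma> |\<subseteq>| \<Delta> \<Longrightarrow> \<Delta> \<tturnstile> \<psi> \<Longrightarrow> \<Delta> \<tturnstile> \<chi>"
  shows "\<Gamma> \<tturnstile> \<chi>"
  by (rule OrE[OF assms(1) discharge[OF assms(2)] discharge[OF assms(3)]])

lemma AllN_intro:
  assumes "\<And>t. \<Gamma> \<tturnstile> instN t \<phi>"
  shows "\<Gamma> \<tturnstile> AllN \<phi>"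
proof -
  obtain x \<sigma> where \<sigma>: "\<forall>\<psi>\<in>fset \<Gamma>. sub \<sigma> SVar \<psi> = wkN \<psi>" "sub \<sigma> SVar (instN (NVar x) \<phi>) = \<phi>"
    using eigenvariable_N[OF finite_fset, of \<Gamma> \<phi>] by blast
  from derivable_sub[OF assms[of "NVar x"], of \<sigma> SVar] show ?thesis
    by (intro AllNI) (simp only: \<sigma> cong: image_cong)
qed

lemma ExN_elim:
  assumes "\<Gamma> \<tturnstile> ExN \<phi>" and "\<And>t \<Delta>. \<Gamma> |\<subseteq>| \<Delta> \<Longrightarrow> \<Delta> \<tturnstile> instN t \<phi> \<Longrightarrow> \<Delta> \<tturnstile> \<chi>"
  shows "\<Gamma> \<tturnstile> \<chi>"
proof -
  obtain x \<sigma> where \<sigma>: "\<forall>\<psi>\<in>insert \<chi> (fset \<Gamma>). sub \<sigma> SVar \<psi> = wkN \<psi>"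
      "sub \<sigma> SVar (instN (NVar x) \<phi>) = \<phi>"
    using eigenvariable_N[of "insert \<chi> (fset \<Gamma>)" \<phi>] by auto
  have "insert (instN (NVar x) \<phi>) (fset \<Gamma>) \<turnstile> \<chi>" by (rule discharge) (rule assms(2))
  from derivable_sub[OF this, of \<sigma> SVar] have "insert \<phi> (wkN ` fset \<Gamma>) \<turnstile> wkN \<chi>"
    by (simp only: image_insert \<sigma> insertI1 insertI2 cong: image_cong)
  with assms(1) show ?thesis by (rule ExNE)
qed

lemma AllS_intro:
  assumes "\<And>a. \<Gamma> \<tturnstile> instS a \<phi>"
  shows "\<Gamma> \<tturnstile> AllS \<phi>"
proof -
  obtain x \<tau> where \<tau>: "\<forall>\<psi>\<in>fset \<Gamma>. sub NVar \<tau> \<psi> = wkS \<psi>" "sub NVar \<tau> (instS (SVar x) \<phi>) = \<phi>"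
    using eigenvariable_S[OF finite_fset, of \<Gamma> \<phi>] by blast
  from derivable_sub[OF assms[of "SVar x"], of NVar \<tau>] show ?thesis
    by (intro AllSI) (simp only: \<tau> cong: image_cong)
qed

lemma ExS_elim:
  assumes "\<Gamma> \<tturnstile> ExS \<phi>" and "\<And>a \<Delta>. \<Gamma> |\<subseteq>| \<Delta> \<Longrightarrow> \<Delta> \<tturnstile> instS a \<phi> \<Longrightarrow> \<Delta> \<tturnstile> \<chi>"
  shows "\<Gamma> \<tturnstile> \<chi>"
proof -
  obtain x \<tau> where \<tau>: "\<forall>\<psi>\<in>insert \<chi> (fset \<Gamma>). sub NVar \<tau> \<psi> = wkS \<psi>"
      "sub NVar \<tau> (instS (SVar x) \<phi>) = \<phi>"
    using eigenvariable_S[of "insert \<chi> (fset \<Gamma>)" \<phi>] by auto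
  have "insert (instS (SVar x) \<phi>) (fset \<Gamma>) \<turnstile> \<chi>" by (rule discharge) (rule assms(2))
  from derivable_sub[OF this, of NVar \<tau>] have "insert \<phi> (wkS ` fset \<Gamma>) \<turnstile> wkS \<chi>"
    by (simp only: image_insert \<tau> insertI1 insertI2 cong: image_cong)
  with assms(1) show ?thesis by (rule ExSE)
qed

lemma Neg_intro: "(\<And>\<Delta>. \<Gamma> |\<subseteq>| \<Delta> \<Longrightarrow> \<Delta> \<tturnstile> \<phi> \<Longrightarrow> \<Delta> \<tturnstile> Fls) \<Longrightarrow> \<Gamma> \<tturnstile> \<^bold>\<not> \<phi>"
  unfolding Neg_def by (rule Imp_intro)

lemma Neg_elim: "\<Gamma> \<tturnstile> \<^bold>\<not> \<phi> \<Longrightarrow> \<Gamma> \<tturnstile> \<phi> \<Longrightarrow> \<Gamma> \<tturnstile> \<chi>"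
  unfolding Neg_def by (rule FlsE[OF ImpE])

lemma Iff_intro:
  assumes "\<And>\<Delta>. \<Gamma> |\<subseteq>| \<Delta> \<Longrightarrow> \<Delta> \<tturnstile> \<phi> \<Longrightarrow> \<Delta> \<tturnstile> \<psi>" and "\<And>\<Delta>. \<Gamma> |\<subseteq>| \<Delta> \<Longrightarrow> \<Delta> \<tturnstile> \<psi> \<Longrightarrow> \<Delta> \<tturnstile> \<phi>"
  shows "\<Gamma> \<tturnstile> \<phi> \<^bold>\<longleftrightarrow> \<psi>"
  unfolding Iff_def by (rule AndI[OF Imp_intro[OF assms(1)] Imp_intro[OF assms(2)]])

lemma Iff_D1: "\<Gamma> \<tturnstile> \<phi> \<^bold>\<longleftrightarrow> \<psi> \<Longrightarrow> \<Gamma> \<tturnstile> \<phi> \<Longrightarrow> \<Gamma> \<tturnstile> \<psi>"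
  unfolding Iff_def by (rule ImpE[OF AndE1])

lemma Iff_D2: "\<Gamma> \<tturnstile> \<phi> \<^bold>\<longleftrightarrow> \<psi> \<Longrightarrow> \<Gamma> \<tturnstile> \<psi> \<Longrightarrow> \<Gamma> \<tturnstile> \<phi>"
  unfolding Iff_def by (rule ImpE[OF AndE2])

section \<open>Equality and arithmetic\<close>

lemma Eq_refl: "\<Gamma> \<tturnstile> t \<^bold>= t"
  by (rule Ax[OF ax.Refl])

lemma Eq_subst: "\<Gamma> \<tturnstile> t \<^bold>= u \<Longrightarrow> \<Gamma> \<tturnstile> instN t \<phi> \<Longrightarrow> \<Gamma> \<tturnstile> instN u \<phi>"
  by (rule ImpE[OF ImpE[OF Ax[OF ax.Leibniz]]])

lemma Eq_sym: "\<Gamma> \<tturnstile> t \<^bold>= u \<Longrightarrow> \<Gamma> \<tturnstile> u \<^bold>= t"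
  using Eq_subst[of \<Gamma> t u "NVar 0 \<^bold>= wkN_n t"] by (simp add: Eq_refl)

lemma Eq_trans [trans]: "\<Gamma> \<tturnstile> t \<^bold>= u \<Longrightarrow> \<Gamma> \<tturnstile> u \<^bold>= v \<Longrightarrow> \<Gamma> \<tturnstile> t \<^bold>= v"
  using Eq_subst[of \<Gamma> u v "wkN_n t \<^bold>= NVar 0"] by simp

lemma Neg_Eq_cong:
  assumes "\<Gamma> \<tturnstile> \<^bold>\<not> (t \<^bold>= u)" and "\<Gamma> \<tturnstile> t \<^bold>= t'" and "\<Gamma> \<tturnstile> u \<^bold>= u'"
  shows "\<Gamma> \<tturnstile> \<^bold>\<not> (t' \<^bold>= u')"
proof (rule Neg_intro)
  fix \<Delta> assume ext: "\<Gamma> |\<subseteq>| \<Delta>" and "\<Delta> \<tturnstile> t' \<^bold>= u'"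
  from this(2) have "\<Delta> \<tturnstile> t \<^bold>= u"
    by (rule Eq_trans[OF weaken[OF assms(2) ext] Eq_trans[OF _ Eq_sym[OF weaken[OF assms(3) ext]]]])
  with weaken[OF assms(1) ext] show "\<Delta> \<tturnstile> Fls" by (rule Neg_elim)
qed

lemma Eq_cong:
  "\<Gamma> \<tturnstile> t \<^bold>= u \<Longrightarrow> \<Gamma> \<tturnstile> sub_n (case_nat t NVar) SVar c \<^bold>= sub_n (case_nat u NVar) SVar c"
  using Eq_subst[of \<Gamma> t u "wkN_n (sub_n (case_nat t NVar) SVar c) \<^bold>= c"] by (simp add: Eq_refl)

lemma Succ_cong: "\<Gamma> \<tturnstile> t \<^bold>= u \<Longrightarrow> \<Gamma> \<tturnstile> Succ t \<^bold>= Succ u"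
  using Eq_cong[of \<Gamma> t u "Succ (NVar 0)"] by simp

lemma Ap_cong: "\<Gamma> \<tturnstile> t \<^bold>= u \<Longrightarrow> \<Gamma> \<tturnstile> Ap a t \<^bold>= Ap a u"
  using Eq_cong[of \<Gamma> t u "Ap (wkN_s a) (NVar 0)"] by simp

lemma bar_cong: "\<Gamma> \<tturnstile> t \<^bold>= u \<Longrightarrow> \<Gamma> \<tturnstile> bar a t \<^bold>= bar a u"
  using Eq_cong[of \<Gamma> t u "bar (wkN_s a) (NVar 0)"] by simp

lemma Rec_cong: "\<Gamma> \<tturnstile> t \<^bold>= u \<Longrightarrow> \<Gamma> \<tturnstile> Rec a b t \<^bold>= Rec a b u"
  using Eq_cong[of \<Gamma> t u "Rec (wkN_n a) (ren_n (up (up Suc)) id b) (NVar 0)"] by simp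

lemma Plus_cong: "\<Gamma> \<tturnstile> u \<^bold>= v \<Longrightarrow> \<Gamma> \<tturnstile> Plus t u \<^bold>= Plus t v"
  unfolding Plus_def by (rule Rec_cong)

lemma Cns_cong: "\<Gamma> \<tturnstile> t \<^bold>= u \<Longrightarrow> \<Gamma> \<tturnstile> s \<^bold>= v \<Longrightarrow> \<Gamma> \<tturnstile> Cns t s \<^bold>= Cns u v"
  using Eq_cong[of \<Gamma> t u "Cns (NVar 0) (wkN_n s)"] Eq_cong[of \<Gamma> s v "Cns (wkN_n u) (NVar 0)"]
  by (auto intro: Eq_trans)

lemma snoc_cong: "\<Gamma> \<tturnstile> t \<^bold>= u \<Longrightarrow> \<Gamma> \<tturnstile> s \<^bold>= v \<Longrightarrow> \<Gamma> \<tturnstile> snoc t s \<^bold>= snoc u v"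
  using Eq_cong[of \<Gamma> t u "snoc (NVar 0) (wkN_n s)"] Eq_cong[of \<Gamma> s v "snoc (wkN_n u) (NVar 0)"]
  by (auto intro: Eq_trans)

lemma Succ_inject: "\<Gamma> \<tturnstile> Succ t \<^bold>= Succ u \<Longrightarrow> \<Gamma> \<tturnstile> t \<^bold>= u"
  by (rule ImpE[OF Ax[OF ax.Succ_inject]])

lemma Succ_eq_Zero: "\<Gamma> \<tturnstile> Succ t \<^bold>= Zero \<Longrightarrow> \<Gamma> \<tturnstile> \<chi>"
  by (rule Neg_elim[OF Ax[OF ax.Succ_nonzero]])

lemma N_induct:
  assumes inst: "\<And>t. instN t \<phi> = P t"
    and "\<Gamma> \<tturnstile> P Zero" and step: "\<And>t \<Delta>. \<Gamma> |\<subseteq>| \<Delta> \<Longrightarrow> \<Delta> \<tturnstile> P t \<Longrightarrow> \<Delta> \<tturnstile> P (Succ t)"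
  shows "\<Gamma> \<tturnstile> P t"
proof -
  have "instN t (sub (case_nat (Succ (NVar 0)) (\<lambda>i. NVar (Suc i))) SVar \<phi>) = P (Succ t)" for t
    using inst[of "Succ t"] by simp
  with inst have "\<Gamma> \<tturnstile> instN t (\<phi> \<^bold>\<longrightarrow> sub (case_nat (Succ (NVar 0)) (\<lambda>i. NVar (Suc i))) SVar \<phi>)" for t
    unfolding sub.simps by (simp only: Imp_intro step)
  moreover have "\<Gamma> \<tturnstile> instN Zero \<phi>" using assms(2) by (simp only: inst)
  ultimately have "\<Gamma> \<tturnstile> AllN \<phi>" by (rule ImpE[OF Ax[OF ax.Induction] AndI[OF _ AllN_intro], rotated])
  from AllNE[OF this, of t] show ?thesis by (simp only: inst)
qed

lemma N_cases:
  assumes "\<And>\<Delta>. \<Gamma> |\<subseteq>| \<Delta> \<Longrightarrow> \<Delta> \<tturnstile> t \<^bold>= Zero \<Longrightarrow> \<Delta> \<tturnstile> \<chi>"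
    and "\<And>k \<Delta>. \<Gamma> |\<subseteq>| \<Delta> \<Longrightarrow> \<Delta> \<tturnstile> t \<^bold>= Succ k \<Longrightarrow> \<Delta> \<tturnstile> \<chi>"
  shows "\<Gamma> \<tturnstile> \<chi>"
proof -
  let ?P = "\<lambda>t. (t \<^bold>= Zero) \<^bold>\<or> ExN (wkN_n t \<^bold>= Succ (NVar 0))"
  have "\<Gamma> \<tturnstile> ?P t"
  proof (rule N_induct[where P = ?P and \<phi> = "?P (NVar 0)"])
    show "instN t (?P (NVar 0)) = ?P t" for t by simp
    show "\<Gamma> \<tturnstile> ?P Zero" by (rule OrI1[OF Eq_refl])
    show "\<Delta> \<tturnstile> ?P (Succ t)" for t \<Delta>
      by (rule OrI2, rule ExNI[of _ t]) (simp add: Eq_refl)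
  qed
  then show ?thesis
  proof (rule Or_elim)
    fix \<Delta> assume ext: "\<Gamma> |\<subseteq>| \<Delta>" and "\<Delta> \<tturnstile> ExN (wkN_n t \<^bold>= Succ (NVar 0))"
    from this(2) show "\<Delta> \<tturnstile> \<chi>"
      by (rule ExN_elim) (rule assms(2)[OF order_trans[OF ext]], simp_all)
  qed (rule assms(1))
qed

lemma Plus_Zero: "\<Gamma> \<tturnstile> Plus t Zero \<^bold>= t"
  unfolding Plus_def by (rule Ax[OF ax.Rec_Zero])

lemma Plus_Succ: "\<Gamma> \<tturnstile> Plus t (Succ u) \<^bold>= Succ (Plus t u)"
  using Ax[OF ax.Rec_Succ[of t "Succ (NVar 0)" u]] by (simp add: Plus_def)

lemma Zero_Plus: "\<Gamma> \<tturnstile> Plus Zero u \<^bold>= u"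
proof (rule N_induct[where P = "\<lambda>u. Plus Zero u \<^bold>= u" and \<phi> = "Plus Zero (NVar 0) \<^bold>= NVar 0"])
  show "\<Delta> \<tturnstile> Plus Zero (Succ u) \<^bold>= Succ u" if "\<Delta> \<tturnstile> Plus Zero u \<^bold>= u" for u \<Delta>
    by (rule Eq_trans[OF Plus_Succ Succ_cong[OF that]])
qed (simp_all add: Plus_Zero)

lemma Succ_Plus: "\<Gamma> \<tturnstile> Plus (Succ t) u \<^bold>= Succ (Plus t u)"
proof (rule N_induct[where P = "\<lambda>u. Plus (Succ t) u \<^bold>= Succ (Plus t u)"
      and \<phi> = "Plus (Succ (wkN_n t)) (NVar 0) \<^bold>= Succ (Plus (wkN_n t) (NVar 0))"])
  show "\<Gamma> \<tturnstile> Plus (Succ t) Zero \<^bold>= Succ (Plus t Zero)"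
    by (rule Eq_trans[OF Plus_Zero Succ_cong[OF Eq_sym[OF Plus_Zero]]])
  show "\<Delta> \<tturnstile> Plus (Succ t) (Succ u) \<^bold>= Succ (Plus t (Succ u))"
    if "\<Delta> \<tturnstile> Plus (Succ t) u \<^bold>= Succ (Plus t u)" for u \<Delta>
    by (rule Eq_trans[OF Plus_Succ Succ_cong[OF Eq_trans[OF that Eq_sym[OF Plus_Succ]]]])
qed simp

lemma LessI: "\<Gamma> \<tturnstile> Plus t (Succ k) \<^bold>= u \<Longrightarrow> \<Gamma> \<tturnstile> Less t u"
  unfolding Less_def by (rule ExNI[of _ k]) simp

lemma LessE:
  assumes "\<Gamma> \<tturnstile> Less t u"
    and "\<And>k \<Delta>. \<Gamma> |\<subseteq>| \<Delta> \<Longrightarrow> \<Delta> \<tturnstile> Succ (Plus t k) \<^bold>= u \<Longrightarrow> \<Delta> \<tturnstile> \<chi>"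
  shows "\<Gamma> \<tturnstile> \<chi>"
proof (rule ExN_elim[OF assms(1)[unfolded Less_def]])
  fix k \<Delta> assume "\<Gamma> |\<subseteq>| \<Delta>" and "\<Delta> \<tturnstile> instN k (Plus (wkN_n t) (Succ (NVar 0)) \<^bold>= wkN_n u)"
  then show "\<Delta> \<tturnstile> \<chi>" by (intro assms(2) Eq_trans[OF Eq_sym[OF Plus_Succ]]) simp_all
qed

lemma Less_Zero: "\<Gamma> \<tturnstile> Less t Zero \<Longrightarrow> \<Gamma> \<tturnstile> \<chi>"
  by (erule LessE) (rule Succ_eq_Zero)

lemma Less_Succ_self: "\<Gamma> \<tturnstile> Less t (Succ t)"
  by (rule LessI[OF Eq_trans[OF Plus_Succ Succ_cong[OF Plus_Zero]]])

lemma eq_or_Less_of_Plus: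
  assumes "\<Gamma> \<tturnstile> Plus t k \<^bold>= u"
  shows "\<Gamma> \<tturnstile> (t \<^bold>= u) \<^bold>\<or> Less t u"
proof (rule N_cases[of _ k])
  fix \<Delta> assume ext: "\<Gamma> |\<subseteq>| \<Delta>" and "\<Delta> \<tturnstile> k \<^bold>= Zero"
  from this(2) have "\<Delta> \<tturnstile> t \<^bold>= Plus t k" by (rule Eq_sym[OF Eq_trans[OF Plus_cong Plus_Zero]])
  then show "\<Delta> \<tturnstile> (t \<^bold>= u) \<^bold>\<or> Less t u" by (rule OrI1[OF Eq_trans[OF _ weaken[OF assms ext]]])
next
  fix j \<Delta> assume ext: "\<Gamma> |\<subseteq>| \<Delta>" and "\<Delta> \<tturnstile> k \<^bold>= Succ j"
  from this(2) have "\<Delta> \<tturnstile> Plus t (Succ j) \<^bold>= Plus t k" by (rule Plus_cong[OF Eq_sym])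
  then show "\<Delta> \<tturnstile> (t \<^bold>= u) \<^bold>\<or> Less t u"
    by (rule OrI2[OF LessI[OF Eq_trans[OF _ weaken[OF assms ext]]]])
qed

lemma Less_SuccD: "\<Gamma> \<tturnstile> Less t (Succ u) \<Longrightarrow> \<Gamma> \<tturnstile> (t \<^bold>= u) \<^bold>\<or> Less t u"
  by (erule LessE) (rule eq_or_Less_of_Plus[OF Succ_inject])

lemma Succ_eq_or_Less: "\<Gamma> \<tturnstile> Less t u \<Longrightarrow> \<Gamma> \<tturnstile> (Succ t \<^bold>= u) \<^bold>\<or> Less (Succ t) u"
  by (erule LessE) (rule eq_or_Less_of_Plus[OF Eq_trans[OF Succ_Plus]])

lemma Less_SuccI: "\<Gamma> \<tturnstile> Less t u \<Longrightarrow> \<Gamma> \<tturnstile> Less t (Succ u)"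
  by (erule LessE) (rule LessI[OF Eq_trans[OF Plus_Succ Succ_cong[OF Eq_trans[OF Plus_Succ]]]])

lemma Less_linear: "\<Gamma> \<tturnstile> Less t u \<^bold>\<or> (t \<^bold>= u) \<^bold>\<or> Less u t"
proof (rule N_induct[where P = "\<lambda>u. Less t u \<^bold>\<or> (t \<^bold>= u) \<^bold>\<or> Less u t"
      and \<phi> = "Less (wkN_n t) (NVar 0) \<^bold>\<or> (wkN_n t \<^bold>= NVar 0) \<^bold>\<or> Less (NVar 0) (wkN_n t)"])
  from eq_or_Less_of_Plus[OF Zero_Plus, of \<Gamma> t]
  show "\<Gamma> \<tturnstile> Less t Zero \<^bold>\<or> (t \<^bold>= Zero) \<^bold>\<or> Less Zero t"
    by (rule Or_elim) (blast intro: OrI1 OrI2 Eq_sym)+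
next
  fix u \<Delta> let ?goal = "Less t (Succ u) \<^bold>\<or> (t \<^bold>= Succ u) \<^bold>\<or> Less (Succ u) t"
  assume "\<Delta> \<tturnstile> Less t u \<^bold>\<or> (t \<^bold>= u) \<^bold>\<or> Less u t"
  then show "\<Delta> \<tturnstile> ?goal"
  proof (elim Or_elim)
    show "\<Theta> \<tturnstile> ?goal" if "\<Theta> \<tturnstile> Less t u" for \<Theta>
      by (rule OrI1[OF Less_SuccI[OF that]])
    show "\<Theta> \<tturnstile> ?goal" if "\<Theta> \<tturnstile> t \<^bold>= u" for \<Theta>
      by (rule OrI1[OF LessI[OF Eq_trans[OF Plus_Succ Succ_cong[OF Eq_trans[OF Plus_Zero that]]]]])
    show "\<Theta> \<tturnstile> ?goal" if "\<Theta> \<tturnstile> Less u t" for \<Theta>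
      by (rule Or_elim[OF Succ_eq_or_Less[OF that]]) (blast intro: OrI1 OrI2 Eq_sym)+
  qed
qed simp

lemma Succ_Plus_neq: "\<Gamma> \<tturnstile> \<^bold>\<not> (Succ (Plus t k) \<^bold>= t)"
proof (rule N_induct[where P = "\<lambda>t. \<^bold>\<not> (Succ (Plus t k) \<^bold>= t)"
      and \<phi> = "\<^bold>\<not> (Succ (Plus (NVar 0) (wkN_n k)) \<^bold>= NVar 0)"])
  show "\<Gamma> \<tturnstile> \<^bold>\<not> (Succ (Plus Zero k) \<^bold>= Zero)" by (rule Ax[OF ax.Succ_nonzero])
  show "\<Delta> \<tturnstile> \<^bold>\<not> (Succ (Plus (Succ t) k) \<^bold>= Succ t)" if "\<Delta> \<tturnstile> \<^bold>\<not> (Succ (Plus t k) \<^bold>= t)" for t \<Delta>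
  proof (rule Neg_intro)
    fix \<Theta> assume ext: "\<Delta> |\<subseteq>| \<Theta>" and "\<Theta> \<tturnstile> Succ (Plus (Succ t) k) \<^bold>= Succ t"
    from this(2) have "\<Theta> \<tturnstile> Succ (Plus t k) \<^bold>= t"
      by (rule Eq_trans[OF Eq_sym[OF Succ_Plus] Succ_inject])
    with weaken[OF that ext] show "\<Theta> \<tturnstile> Fls" by (rule Neg_elim)
  qed
qed simp

lemma Less_neq: "\<Gamma> \<tturnstile> Less t u \<Longrightarrow> \<Gamma> \<tturnstile> \<^bold>\<not> (t \<^bold>= u)"
proof (erule LessE, rule Neg_intro)
  fix k \<Delta> \<Theta> assume "\<Delta> \<tturnstile> Succ (Plus t k) \<^bold>= u" "\<Delta> |\<subseteq>| \<Theta>" "\<Theta> \<tturnstile> t \<^bold>= u"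
  then have "\<Theta> \<tturnstile> Succ (Plus t k) \<^bold>= t" by (blast intro: weaken Eq_trans[OF _ Eq_sym])
  with Succ_Plus_neq show "\<Theta> \<tturnstile> Fls" by (rule Neg_elim)
qed

lemma Neg_Eq_sym: "\<Gamma> \<tturnstile> \<^bold>\<not> (t \<^bold>= u) \<Longrightarrow> \<Gamma> \<tturnstile> \<^bold>\<not> (u \<^bold>= t)"
  by (rule Neg_intro) (rule Neg_elim[OF weaken Eq_sym])

lemma Eq_decidable: "\<Gamma> \<tturnstile> (t \<^bold>= u) \<^bold>\<or> \<^bold>\<not> (t \<^bold>= u)"
  using Less_linear[of \<Gamma> t u] by (elim Or_elim) (blast intro: OrI1 OrI2 Less_neq Neg_Eq_sym)+

section \<open>Sequences\<close>

lemma seq_eqI: "(\<And>n. \<Gamma> \<tturnstile> Ap a n \<^bold>= Ap b n) \<Longrightarrow> \<Gamma> \<tturnstile> seq_eq a b"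
  unfolding seq_eq_def by (rule AllN_intro) simp

lemma seq_eqD: "\<Gamma> \<tturnstile> seq_eq a b \<Longrightarrow> \<Gamma> \<tturnstile> Ap a n \<^bold>= Ap b n"
  using AllNE[of "fset \<Gamma>" _ n] by (fastforce simp: seq_eq_def)

lemma seq_eq_trans: "\<Gamma> \<tturnstile> seq_eq a b \<Longrightarrow> \<Gamma> \<tturnstile> seq_eq b c \<Longrightarrow> \<Gamma> \<tturnstile> seq_eq a c"
  by (rule seq_eqI) (rule Eq_trans[OF seq_eqD seq_eqD])

lemma seq_eq_sym: "\<Gamma> \<tturnstile> seq_eq a b \<Longrightarrow> \<Gamma> \<tturnstile> seq_eq b a"
  by (rule seq_eqI) (rule Eq_sym[OF seq_eqD])

lemma apartI: "\<Gamma> \<tturnstile> \<^bold>\<not> (Ap a n \<^bold>= Ap b n) \<Longrightarrow> \<Gamma> \<tturnstile> apart a b"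
  unfolding apart_def by (rule ExNI[of _ n]) simp

lemma apartE:
  assumes "\<Gamma> \<tturnstile> apart a b"
    and "\<And>n \<Delta>. \<Gamma> |\<subseteq>| \<Delta> \<Longrightarrow> \<Delta> \<tturnstile> \<^bold>\<not> (Ap a n \<^bold>= Ap b n) \<Longrightarrow> \<Delta> \<tturnstile> \<chi>"
  shows "\<Gamma> \<tturnstile> \<chi>"
  by (rule ExN_elim[OF assms(1)[unfolded apart_def]]) (rule assms(2), simp_all)

lemma apart_seq_eq: "\<Gamma> \<tturnstile> apart a b \<Longrightarrow> \<Gamma> \<tturnstile> seq_eq a b \<Longrightarrow> \<Gamma> \<tturnstile> \<chi>"
  by (erule apartE) (rule Neg_elim[OF _ seq_eqD[OF weaken]])

lemma Ap_zero_seq: "\<Gamma> \<tturnstile> Ap zero_seq n \<^bold>= Zero"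
  using Ax[OF ax.Beta[of Zero n]] by (simp add: zero_seq_def)

lemma Ap_zero_seq_eq: "\<Gamma> \<tturnstile> Ap zero_seq m \<^bold>= Ap zero_seq n"
  by (rule Eq_trans[OF Ap_zero_seq Eq_sym[OF Ap_zero_seq]])

lemma seq_eq_zero_seqI: "(\<And>n. \<Gamma> \<tturnstile> Ap a n \<^bold>= Zero) \<Longrightarrow> \<Gamma> \<tturnstile> seq_eq a zero_seq"
  by (rule seq_eqI) (rule Eq_trans[OF _ Eq_sym[OF Ap_zero_seq]])

lemma Ap_sect: "\<Gamma> \<tturnstile> Ap (sect a m) n \<^bold>= Ap a (Cns m n)"
  using Ax[OF ax.Beta[of "Ap (wkN_s a) (Cns (wkN_n m) (NVar 0))" n]] by (simp add: sect_def)

lemma sect_cong: "\<Gamma> \<tturnstile> seq_eq a b \<Longrightarrow> \<Gamma> \<tturnstile> seq_eq (sect a i) (sect b i)"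
  by (rule seq_eqI) (rule Eq_trans[OF Ap_sect Eq_trans[OF seq_eqD Eq_sym[OF Ap_sect]]])

lemma bar_Zero: "\<Gamma> \<tturnstile> bar a Zero \<^bold>= Zero"
  unfolding bar_def by (rule Ax[OF ax.Rec_Zero])

lemma bar_Succ: "\<Gamma> \<tturnstile> bar a (Succ n) \<^bold>= snoc (bar a n) (Ap a n)"
  using Ax[OF ax.Rec_Succ[of Zero "snoc (NVar 0) (Ap (wkN_s (wkN_s a)) (NVar 1))" n]]
  by (simp add: bar_def)

lemma bar_Succ_cong:
  "\<Gamma> \<tturnstile> bar a n \<^bold>= bar b n \<Longrightarrow> \<Gamma> \<tturnstile> Ap a n \<^bold>= Ap b n \<Longrightarrow> \<Gamma> \<tturnstile> bar a (Succ n) \<^bold>= bar b (Succ n)"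
  by (rule Eq_trans[OF Eq_trans[OF bar_Succ snoc_cong] Eq_sym[OF bar_Succ]])

lemma bar_eq_or_apart: "\<Gamma> \<tturnstile> (bar a n \<^bold>= bar b n) \<^bold>\<or> apart a b"
proof (rule N_induct[where P = "\<lambda>n. (bar a n \<^bold>= bar b n) \<^bold>\<or> apart a b"
      and \<phi> = "(bar (wkN_s a) (NVar 0) \<^bold>= bar (wkN_s b) (NVar 0)) \<^bold>\<or> apart (wkN_s a) (wkN_s b)"])
  show "\<Gamma> \<tturnstile> (bar a Zero \<^bold>= bar b Zero) \<^bold>\<or> apart a b"
    by (rule OrI1[OF Eq_trans[OF bar_Zero Eq_sym[OF bar_Zero]]])
next
  fix n \<Delta> let ?goal = "(bar a (Succ n) \<^bold>= bar b (Succ n)) \<^bold>\<or> apart a b"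
  assume "\<Delta> \<tturnstile> (bar a n \<^bold>= bar b n) \<^bold>\<or> apart a b"
  then show "\<Delta> \<tturnstile> ?goal"
  proof (rule Or_elim)
    fix \<Theta> assume eq: "\<Theta> \<tturnstile> bar a n \<^bold>= bar b n"
    show "\<Theta> \<tturnstile> ?goal"
      by (rule Or_elim[OF Eq_decidable[of _ "Ap a n" "Ap b n"]])
        (blast intro: OrI1 OrI2 bar_Succ_cong apartI weaken[OF eq])+
  qed (rule OrI2)
qed simp

lemma bar_Succ_Cns:
  assumes "\<And>n. \<Gamma> \<tturnstile> Ap c (Succ n) \<^bold>= Ap a n"
  shows "\<Gamma> \<tturnstile> bar c (Succ n) \<^bold>= Cns (Ap c Zero) (bar a n)"
proof (rule N_induct[where P = "\<lambda>n. bar c (Succ n) \<^bold>= Cns (Ap c Zero) (bar a n)"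
      and \<phi> = "bar (wkN_s c) (Succ (NVar 0)) \<^bold>= Cns (Ap (wkN_s c) Zero) (bar (wkN_s a) (NVar 0))"])
  have "\<Gamma> \<tturnstile> bar c (Succ Zero) \<^bold>= snoc Zero (Ap c Zero)"
    by (rule Eq_trans[OF bar_Succ snoc_cong[OF bar_Zero Eq_refl]])
  also have "\<Gamma> \<tturnstile> snoc Zero (Ap c Zero) \<^bold>= Cns (Ap c Zero) Zero"
    unfolding snoc_def by (rule Ax[OF ax.Append_Zero])
  also have "\<Gamma> \<tturnstile> Cns (Ap c Zero) Zero \<^bold>= Cns (Ap c Zero) (bar a Zero)"
    by (rule Cns_cong[OF Eq_refl Eq_sym[OF bar_Zero]])
  finally show "\<Gamma> \<tturnstile> bar c (Succ Zero) \<^bold>= Cns (Ap c Zero) (bar a Zero)" .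
next
  fix n \<Delta> assume ext: "\<Gamma> |\<subseteq>| \<Delta>" and IH: "\<Delta> \<tturnstile> bar c (Succ n) \<^bold>= Cns (Ap c Zero) (bar a n)"
  have "\<Delta> \<tturnstile> bar c (Succ (Succ n)) \<^bold>= snoc (Cns (Ap c Zero) (bar a n)) (Ap a n)"
    by (rule Eq_trans[OF bar_Succ snoc_cong[OF IH weaken[OF assms ext]]])
  also have "\<Delta> \<tturnstile> snoc (Cns (Ap c Zero) (bar a n)) (Ap a n) \<^bold>=
      Cns (Ap c Zero) (snoc (bar a n) (Ap a n))"
    unfolding snoc_def by (rule Ax[OF ax.Append_Cns])
  also have "\<Delta> \<tturnstile> Cns (Ap c Zero) (snoc (bar a n) (Ap a n)) \<^bold>= Cns (Ap c Zero) (bar a (Succ n))"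
    by (rule Cns_cong[OF Eq_refl Eq_sym[OF bar_Succ]])
  finally show "\<Delta> \<tturnstile> bar c (Succ (Succ n)) \<^bold>= Cns (Ap c Zero) (bar a (Succ n))" .
qed simp

definition prepend :: "ntm \<Rightarrow> stm \<Rightarrow> stm"
  where "prepend t a = Lam (Rec (wkN_n t) (Ap (wkN_s (wkN_s (wkN_s a))) (NVar 1)) (NVar 0))"

lemma Ap_prepend: "\<Gamma> \<tturnstile> Ap (prepend t a) n \<^bold>= Rec t (Ap (wkN_s (wkN_s a)) (NVar 1)) n"
  using Ax[OF ax.Beta[of "Rec (wkN_n t) (Ap (wkN_s (wkN_s (wkN_s a))) (NVar 1)) (NVar 0)" n]]
  by (simp add: prepend_def)

lemma Ap_prepend_Zero: "\<Gamma> \<tturnstile> Ap (prepend t a) Zero \<^bold>= t"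
  by (rule Eq_trans[OF Ap_prepend Ax[OF ax.Rec_Zero]])

lemma Ap_prepend_Succ: "\<Gamma> \<tturnstile> Ap (prepend t a) (Succ n) \<^bold>= Ap a n"
  using Eq_trans[OF Ap_prepend Ax[OF ax.Rec_Succ]] by simp

lemma bar_prepend: "\<Gamma> \<tturnstile> bar (prepend t a) (Succ n) \<^bold>= Cns t (bar a n)"
  by (rule Eq_trans[OF bar_Succ_Cns[OF Ap_prepend_Succ] Cns_cong[OF Ap_prepend_Zero Eq_refl]])

lemma bar_zero_seq_Succ: "\<Gamma> \<tturnstile> bar zero_seq (Succ n) \<^bold>= Cns Zero (bar zero_seq n)"
  by (rule Eq_trans[OF bar_Succ_Cns[OF Ap_zero_seq_eq] Cns_cong[OF Ap_zero_seq Eq_refl]])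

lemma prepend_apart_zero_seq:
  assumes "\<Gamma> \<tturnstile> apart a zero_seq"
  shows "\<Gamma> \<tturnstile> apart (prepend t a) zero_seq"
proof (rule apartE[OF assms])
  fix n \<Delta> assume "\<Delta> \<tturnstile> \<^bold>\<not> (Ap a n \<^bold>= Ap zero_seq n)"
  from Neg_Eq_cong[OF this Eq_sym[OF Ap_prepend_Succ] Ap_zero_seq_eq]
  show "\<Delta> \<tturnstile> apart (prepend t a) zero_seq" by (rule apartI)
qed

lemma near_zero_seq_apart:
  "\<Gamma> \<tturnstile> ExS ((bar (SVar 0) (wkS_n n) \<^bold>= bar zero_seq (wkS_n n)) \<^bold>\<and> apart (SVar 0) zero_seq)"
proof -
  let ?P = "\<lambda>n. ExS ((bar (SVar 0) (wkS_n n) \<^bold>= bar zero_seq (wkS_n n)) \<^bold>\<and> apart (SVar 0) zero_seq)"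
  have intro: "\<Delta> \<tturnstile> ?P n" if "\<Delta> \<tturnstile> bar d n \<^bold>= bar zero_seq n" "\<Delta> \<tturnstile> apart d zero_seq" for d n \<Delta>
    by (rule ExSI[of _ d]) (simp add: AndI that)
  show ?thesis
  proof (rule N_induct[where P = ?P and \<phi> = "?P (NVar 0)"])
    have "\<Gamma> \<tturnstile> apart (prepend (Succ Zero) zero_seq) zero_seq"
      by (rule apartI, rule Neg_Eq_cong)
        (rule Ax[OF ax.Succ_nonzero] Eq_sym[OF Ap_prepend_Zero] Eq_sym[OF Ap_zero_seq])+
    then show "\<Gamma> \<tturnstile> ?P Zero" by (rule intro[OF Eq_trans[OF bar_Zero Eq_sym[OF bar_Zero]]])
  next
    fix n \<Delta> assume "\<Delta> \<tturnstile> ?P n"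
    then show "\<Delta> \<tturnstile> ?P (Succ n)"
    proof (rule ExS_elim)
      fix d \<Theta>
      assume "\<Theta> \<tturnstile> instS d ((bar (SVar 0) (wkS_n n) \<^bold>= bar zero_seq (wkS_n n)) \<^bold>\<and>
        apart (SVar 0) zero_seq)"
      then have d: "\<Theta> \<tturnstile> (bar d n \<^bold>= bar zero_seq n) \<^bold>\<and> apart d zero_seq" by simp
      have "\<Theta> \<tturnstile> bar (prepend Zero d) (Succ n) \<^bold>= bar zero_seq (Succ n)"
        by (rule Eq_trans[OF bar_prepend
              Eq_trans[OF Cns_cong[OF Eq_refl AndE1[OF d]] Eq_sym[OF bar_zero_seq_Succ]]])
      then show "\<Theta> \<tturnstile> ?P (Succ n)" by (rule intro[OF _ prepend_apart_zero_seq[OF AndE2[OF d]]])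
    qed
  qed simp
qed

section \<open>Values of continuous functions\<close>

definition zero_below :: "stm \<Rightarrow> stm \<Rightarrow> ntm \<Rightarrow> fm"
  where "zero_below g a m =
    AllN (Less (NVar 0) (wkN_n m) \<^bold>\<longrightarrow> Ap (wkN_s g) (bar (wkN_s a) (NVar 0)) \<^bold>= Zero)"

lemma sub_zero_below [simp]:
  "sub \<sigma> \<tau> (zero_below g a m) = zero_below (sub_s \<sigma> \<tau> g) (sub_s \<sigma> \<tau> a) (sub_n \<sigma> \<tau> m)"
  by (simp add: zero_below_def)

lemma zero_belowI:
  assumes "\<And>n \<Delta>. \<Gamma> |\<subseteq>| \<Delta> \<Longrightarrow> \<Delta> \<tturnstile> Less n m \<Longrightarrow> \<Delta> \<tturnstile> Ap g (bar a n) \<^bold>= Zero"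
  shows "\<Gamma> \<tturnstile> zero_below g a m"
  unfolding zero_below_def by (rule AllN_intro) (simp add: Imp_intro assms)

lemma zero_belowD:
  assumes "\<Gamma> \<tturnstile> zero_below g a m" and "\<Gamma> \<tturnstile> Less n m"
  shows "\<Gamma> \<tturnstile> Ap g (bar a n) \<^bold>= Zero"
  using AllNE[OF assms(1)[unfolded zero_below_def], of n] by (simp add: ImpE[OF _ assms(2)])

lemma zero_below_Succ:
  assumes "\<Gamma> \<tturnstile> zero_below g a m" and "\<Gamma> \<tturnstile> Ap g (bar a m) \<^bold>= Zero"
  shows "\<Gamma> \<tturnstile> zero_below g a (Succ m)"
proof (rule zero_belowI)
  fix n \<Delta> assume ext: "\<Gamma> |\<subseteq>| \<Delta>" and "\<Delta> \<tturnstile> Less n (Succ m)"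
  from Less_SuccD[OF this(2)] show "\<Delta> \<tturnstile> Ap g (bar a n) \<^bold>= Zero"
  proof (rule Or_elim)
    show "\<Theta> \<tturnstile> Ap g (bar a n) \<^bold>= Zero" if "\<Delta> |\<subseteq>| \<Theta>" "\<Theta> \<tturnstile> n \<^bold>= m" for \<Theta>
      by (rule Eq_trans[OF Ap_cong[OF bar_cong[OF that(2)]]
            weaken[OF assms(2) order_trans[OF ext that(1)]]])
    show "\<Theta> \<tturnstile> Ap g (bar a n) \<^bold>= Zero" if "\<Delta> |\<subseteq>| \<Theta>" "\<Theta> \<tturnstile> Less n m" for \<Theta>
      by (rule zero_belowD[OF weaken[OF assms(1) order_trans[OF ext that(1)]] that(2)])
  qed
qed

lemma num_value_eq:
  "num_value g a p = ExN ((Ap (wkN_s g) (bar (wkN_s a) (NVar 0)) \<^bold>= Succ (wkN_n p)) \<^bold>\<and>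
    zero_below (wkN_s g) (wkN_s a) (NVar 0))"
  by (simp add: num_value_def zero_below_def)

lemma num_valueI:
  "\<Gamma> \<tturnstile> Ap g (bar a m) \<^bold>= Succ p \<Longrightarrow> \<Gamma> \<tturnstile> zero_below g a m \<Longrightarrow> \<Gamma> \<tturnstile> num_value g a p"
  unfolding num_value_eq by (rule ExNI[of _ m]) (simp add: AndI)

lemma num_valueE:
  assumes "\<Gamma> \<tturnstile> num_value g a p"
    and "\<And>m \<Delta>. \<Gamma> |\<subseteq>| \<Delta> \<Longrightarrow> \<Delta> \<tturnstile> Ap g (bar a m) \<^bold>= Succ p \<Longrightarrow> \<Delta> \<tturnstile> zero_below g a m \<Longrightarrow> \<Delta> \<tturnstile> \<chi>"
  shows "\<Gamma> \<tturnstile> \<chi>"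
proof (rule ExN_elim[OF assms(1)[unfolded num_value_eq]])
  fix m \<Delta> assume ext: "\<Gamma> |\<subseteq>| \<Delta>"
    and "\<Delta> \<tturnstile> instN m ((Ap (wkN_s g) (bar (wkN_s a) (NVar 0)) \<^bold>= Succ (wkN_n p)) \<^bold>\<and>
      zero_below (wkN_s g) (wkN_s a) (NVar 0))"
  then have "\<Delta> \<tturnstile> (Ap g (bar a m) \<^bold>= Succ p) \<^bold>\<and> zero_below g a m" by simp
  then show "\<Delta> \<tturnstile> \<chi>" by (blast intro: assms(2)[OF ext] AndE1 AndE2)
qed

lemma zero_below_or_num_value:
  "\<Gamma> \<tturnstile> zero_below g a m \<^bold>\<or> ExN (num_value (wkN_s g) (wkN_s a) (NVar 0))"
proof -
  let ?ex = "\<lambda>g a. ExN (num_value (wkN_s g) (wkN_s a) (NVar 0))"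
  let ?P = "\<lambda>g a m. zero_below g a m \<^bold>\<or> ?ex g a"
  show ?thesis
  proof (rule N_induct[where P = "?P g a" and \<phi> = "?P (wkN_s g) (wkN_s a) (NVar 0)"])
    show "\<Gamma> \<tturnstile> ?P g a Zero" by (rule OrI1[OF zero_belowI]) (rule Less_Zero)
  next
    fix m \<Delta> assume "\<Delta> \<tturnstile> ?P g a m"
    then show "\<Delta> \<tturnstile> ?P g a (Succ m)"
    proof (rule Or_elim)
      fix \<Theta> assume below: "\<Theta> \<tturnstile> zero_below g a m"
      show "\<Theta> \<tturnstile> ?P g a (Succ m)"
      proof (rule N_cases[of _ "Ap g (bar a m)"])
        show "\<Lambda> \<tturnstile> ?P g a (Succ m)" if "\<Theta> |\<subseteq>| \<Lambda>" "\<Lambda> \<tturnstile> Ap g (bar a m) \<^bold>= Zero" for \<Lambda>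
          by (rule OrI1[OF zero_below_Succ[OF weaken[OF below that(1)] that(2)]])
        show "\<Lambda> \<tturnstile> ?P g a (Succ m)" if "\<Theta> |\<subseteq>| \<Lambda>" "\<Lambda> \<tturnstile> Ap g (bar a m) \<^bold>= Succ p" for p \<Lambda>
          by (rule OrI2, rule ExNI[of _ p])
            (simp add: num_valueI[OF that(2) weaken[OF below that(1)]])
      qed
    qed (rule OrI2)
  qed simp
qed

lemma num_value_exists:
  assumes "\<Gamma> \<tturnstile> \<^bold>\<not> (Ap g (bar a m) \<^bold>= Zero)"
  shows "\<Gamma> \<tturnstile> ExN (num_value (wkN_s g) (wkN_s a) (NVar 0))"
proof (rule Or_elim[OF zero_below_or_num_value])
  fix \<Delta> assume ext: "\<Gamma> |\<subseteq>| \<Delta>" and "\<Delta> \<tturnstile> zero_below g a (Succ m)"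
  from Neg_elim[OF weaken[OF assms ext] zero_belowD[OF this(2) Less_Succ_self]]
  show "\<Delta> \<tturnstile> ExN (num_value (wkN_s g) (wkN_s a) (NVar 0))" .
qed

lemma num_value_unique:
  assumes "\<Gamma> \<tturnstile> num_value g a p" and "\<Gamma> \<tturnstile> num_value g a p'"
  shows "\<Gamma> \<tturnstile> p \<^bold>= p'"
proof -
  have not_Less: "\<Delta> \<tturnstile> \<chi>"
    if "\<Delta> \<tturnstile> Less m m'" "\<Delta> \<tturnstile> Ap g (bar a m) \<^bold>= Succ p" "\<Delta> \<tturnstile> zero_below g a m'" for \<Delta> m m' p \<chi>
    by (rule Succ_eq_Zero[OF Eq_trans[OF Eq_sym[OF that(2)] zero_belowD[OF that(3,1)]]])
  show ?thesis
  proof (rule num_valueE[OF assms(1)], rule num_valueE[OF weaken[OF assms(2)]], assumption)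
    fix m \<Delta> m' \<Theta> assume "\<Delta> |\<subseteq>| \<Theta>" "\<Delta> \<tturnstile> Ap g (bar a m) \<^bold>= Succ p" "\<Delta> \<tturnstile> zero_below g a m"
      and m': "\<Theta> \<tturnstile> Ap g (bar a m') \<^bold>= Succ p'" "\<Theta> \<tturnstile> zero_below g a m'"
    then have m: "\<Theta> \<tturnstile> Ap g (bar a m) \<^bold>= Succ p" "\<Theta> \<tturnstile> zero_below g a m" by (blast intro: weaken)+
    from Less_linear[of \<Theta> m m'] show "\<Theta> \<tturnstile> p \<^bold>= p'"
    proof (elim Or_elim)
      show "\<Lambda> \<tturnstile> p \<^bold>= p'" if "\<Theta> |\<subseteq>| \<Lambda>" "\<Lambda> \<tturnstile> Less m m'" for \<Lambda>
        by (rule not_Less[OF that(2) weaken[OF m(1) that(1)] weaken[OF m'(2) that(1)]])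
    next
      fix \<Lambda> \<Xi> assume ext: "\<Theta> |\<subseteq>| \<Lambda>" "\<Lambda> |\<subseteq>| \<Xi>"
      note in_ext = weaken[OF weaken[OF _ ext(1)] ext(2)]
      show "\<Xi> \<tturnstile> p \<^bold>= p'" if "\<Xi> \<tturnstile> m \<^bold>= m'"
        by (rule Succ_inject[OF Eq_trans[OF Eq_sym[OF in_ext[OF m(1)]]
                Eq_trans[OF Ap_cong[OF bar_cong[OF that]] in_ext[OF m'(1)]]]])
      show "\<Xi> \<tturnstile> p \<^bold>= p'" if "\<Xi> \<tturnstile> Less m' m"
        by (rule not_Less[OF that in_ext[OF m'(1)] in_ext[OF m(2)]])
    qed
  qed
qed

lemma fun_valueI:
  "(\<And>n. \<Gamma> \<tturnstile> num_value (sect g n) a (Ap c n)) \<Longrightarrow> \<Gamma> \<tturnstile> fun_value g a c"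
  unfolding fun_value_def by (rule AllN_intro) simp

lemma fun_valueD: "\<Gamma> \<tturnstile> fun_value g a c \<Longrightarrow> \<Gamma> \<tturnstile> num_value (sect g n) a (Ap c n)"
  using AllNE[of "fset \<Gamma>" _ n] by (fastforce simp: fun_value_def)

lemma fun_value_cong:
  assumes "\<Gamma> \<tturnstile> fun_value g a c" and "\<Gamma> \<tturnstile> seq_eq c c'"
  shows "\<Gamma> \<tturnstile> fun_value g a c'"
proof (rule fun_valueI)
  fix n
  from Eq_subst[OF seq_eqD[OF assms(2)], of n "num_value (wkN_s (sect g n)) (wkN_s a) (NVar 0)"]
  show "\<Gamma> \<tturnstile> num_value (sect g n) a (Ap c' n)" using fun_valueD[OF assms(1)] by simp
qed

lemma fun_value_unique:
  "\<Gamma> \<tturnstile> fun_value g a c \<Longrightarrow> \<Gamma> \<tturnstile> fun_value g a c' \<Longrightarrow> \<Gamma> \<tturnstile> seq_eq c c'"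
  by (rule seq_eqI) (rule num_value_unique[OF fun_valueD fun_valueD])

lemma codes_funD:
  assumes "\<Gamma> \<tturnstile> codes_fun g b" and "\<Gamma> \<tturnstile> in_spread b a"
  shows "\<Gamma> \<tturnstile> ExN (\<^bold>\<not> (Ap (sect (wkN_s g) (wkN_n n)) (bar (wkN_s a) (NVar 0)) \<^bold>= Zero))"
proof -
  have "\<Gamma> \<tturnstile> AllS (in_spread (wkS_s b) (SVar 0) \<^bold>\<longrightarrow>
      ExN (\<^bold>\<not> (Ap (sect (wkN_s (wkS_s g)) (wkN_n (wkS_n n))) (bar (SVar 0) (NVar 0)) \<^bold>= Zero)))"
    using AllNE[OF assms(1)[unfolded codes_fun_def], of n] by simp
  from AllSE[OF this, of a] show ?thesis by (simp add: ImpE[OF _ assms(2)])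
qed

lemma fun_value_exists:
  assumes "\<Gamma> \<tturnstile> codes_fun g b" and "\<Gamma> \<tturnstile> in_spread b a"
  shows "\<Gamma> \<tturnstile> ExS (fun_value (wkS_s g) (wkS_s a) (SVar 0))"
proof -
  let ?value = "num_value (sect (wkN_s (wkN_s g)) (NVar 1)) (wkN_s (wkN_s a)) (NVar 0)"
  have "\<Gamma> \<tturnstile> ExN (num_value (sect (wkN_s g) (wkN_n n)) (wkN_s a) (NVar 0))" for n
  proof (rule ExN_elim[OF codes_funD[OF assms, of n]])
    fix m \<Delta>
    assume "\<Delta> \<tturnstile> instN m (\<^bold>\<not> (Ap (sect (wkN_s g) (wkN_n n)) (bar (wkN_s a) (NVar 0)) \<^bold>= Zero))"
    then have "\<Delta> \<tturnstile> \<^bold>\<not> (Ap (sect g n) (bar a m) \<^bold>= Zero)" by simp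
    from num_value_exists[OF this]
    show "\<Delta> \<tturnstile> ExN (num_value (sect (wkN_s g) (wkN_n n)) (wkN_s a) (NVar 0))" by simp
  qed
  then have "\<Gamma> \<tturnstile> AllN (ExN ?value)" by (intro AllN_intro) simp
  from ImpE[OF Ax[OF ax.AC00] this] show ?thesis by (simp add: fun_value_def)
qed

section \<open>The Continuity Principle\<close>

lemma spread_law_zero_seq: "\<Gamma> \<tturnstile> spread_law zero_seq"
  unfolding spread_law_def
  by (rule AllN_intro, simp, rule Iff_intro, rule ExNI[of _ Zero]) (simp_all add: Ap_zero_seq)

lemma in_spread_zero_seq: "\<Gamma> \<tturnstile> in_spread zero_seq a"
  unfolding in_spread_def by (rule AllN_intro) (simp add: Ap_zero_seq)

text \<open>In \<open>all_near b a m \<phi>\<close> the element of the spread near \<open>a\<close> is the variable \<open>SVar 0\<close> of \<open>\<phi>\<close>.\<close>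

definition all_near :: "stm \<Rightarrow> stm \<Rightarrow> ntm \<Rightarrow> fm \<Rightarrow> fm"
  where "all_near b a m \<phi> = AllS (in_spread (wkS_s b) (SVar 0) \<^bold>\<longrightarrow>
    (bar (SVar 0) (wkS_n m) \<^bold>= bar (wkS_s a) (wkS_n m)) \<^bold>\<longrightarrow> \<phi>)"

lemma sub_all_near [simp]:
  "sub \<sigma> \<tau> (all_near b a m \<phi>) = all_near (sub_s \<sigma> \<tau> b) (sub_s \<sigma> \<tau> a) (sub_n \<sigma> \<tau> m)
    (sub (\<lambda>i. wkS_n (\<sigma> i)) (upS \<tau>) \<phi>)"
  by (simp add: all_near_def)

lemma all_nearD:
  assumes "\<Gamma> \<tturnstile> all_near b a m \<phi>" and "\<Gamma> \<tturnstile> in_spread b c" and "\<Gamma> \<tturnstile> bar c m \<^bold>= bar a m"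
  shows "\<Gamma> \<tturnstile> instS c \<phi>"
proof -
  have "\<Gamma> \<tturnstile> in_spread b c \<^bold>\<longrightarrow> (bar c m \<^bold>= bar a m) \<^bold>\<longrightarrow> instS c \<phi>"
    using AllSE[OF assms(1)[unfolded all_near_def], of c] by simp
  from ImpE[OF ImpE[OF this assms(2)] assms(3)] show ?thesis .
qed

lemma continuity_principle:
  assumes "\<Gamma> \<tturnstile> spread_law b" and "\<Gamma> \<tturnstile> in_spread b a"
    and total: "\<And>c \<Delta>. \<Gamma> |\<subseteq>| \<Delta> \<Longrightarrow> \<Delta> \<tturnstile> in_spread b c \<Longrightarrow> \<Delta> \<tturnstile> instS c (ExN \<phi>)"
    and modulus: "\<And>m n \<Delta>. \<Gamma> |\<subseteq>| \<Delta> \<Longrightarrow> \<Delta> \<tturnstile> all_near b a m (instN (wkS_n n) \<phi>) \<Longrightarrow> \<Delta> \<tturnstile> \<chi>"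
  shows "\<Gamma> \<tturnstile> \<chi>"
proof -
  have "\<Gamma> \<tturnstile> instS c (in_spread (wkS_s b) (SVar 0) \<^bold>\<longrightarrow> ExN \<phi>)" for c
    unfolding sub.simps(5) by (rule Imp_intro) (rule total, simp_all)
  then have "\<Gamma> \<tturnstile> AllS (in_spread (wkS_s b) (SVar 0) \<^bold>\<longrightarrow> ExN \<phi>)" by (rule AllS_intro)
  from AllSE[OF ImpE[OF ImpE[OF Ax[OF ax.BCP] assms(1)] this], of a]
  have "\<Gamma> \<tturnstile> ExN (ExN (all_near (wkN_s (wkN_s b)) (wkN_s (wkN_s a)) (NVar 1)
      (sub (case_nat (NVar 0) (\<lambda>i. NVar (Suc (Suc i)))) SVar \<phi>)))"
    by (simp add: all_near_def ImpE[OF _ assms(2)])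
  then show ?thesis
  proof (elim ExN_elim)
    fix m \<Delta> assume ext: "\<Gamma> |\<subseteq>| \<Delta>"
      and "\<Delta> \<tturnstile> instN m (ExN (all_near (wkN_s (wkN_s b)) (wkN_s (wkN_s a)) (NVar 1)
        (sub (case_nat (NVar 0) (\<lambda>i. NVar (Suc (Suc i)))) SVar \<phi>)))"
    then have "\<Delta> \<tturnstile> ExN (all_near (wkN_s b) (wkN_s a) (wkN_n m) \<phi>)" by simp
    then show "\<Delta> \<tturnstile> \<chi>"
      by (rule ExN_elim) (rule modulus[OF order_trans[OF ext]], assumption, simp)
  qed
qed

section \<open>The axes of \<open>D\<^sup>2(A\<^sub>1)\<close>\<close>

definition if_zero :: "ntm \<Rightarrow> ntm \<Rightarrow> ntm \<Rightarrow> ntm"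
  where "if_zero n t u = Rec t (wkN_n (wkN_n u)) n"

lemma sub_if_zero [simp]:
  "sub_n \<sigma> \<tau> (if_zero n t u) = if_zero (sub_n \<sigma> \<tau> n) (sub_n \<sigma> \<tau> t) (sub_n \<sigma> \<tau> u)"
  by (simp add: if_zero_def)

lemma if_zero_Zero: "\<Gamma> \<tturnstile> n \<^bold>= Zero \<Longrightarrow> \<Gamma> \<tturnstile> if_zero n t u \<^bold>= t"
  unfolding if_zero_def by (rule Eq_trans[OF Rec_cong Ax[OF ax.Rec_Zero]])

lemma if_zero_Succ: "\<Gamma> \<tturnstile> n \<^bold>= Succ k \<Longrightarrow> \<Gamma> \<tturnstile> if_zero n t u \<^bold>= u"
  using Ax[OF ax.Rec_Succ[of t "wkN_n (wkN_n u)" k], of "fset \<Gamma>"]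
  by (simp add: if_zero_def Eq_trans[OF Rec_cong])

lemma if_zero_same:
  assumes "\<Gamma> \<tturnstile> t \<^bold>= v" and "\<Gamma> \<tturnstile> u \<^bold>= v"
  shows "\<Gamma> \<tturnstile> if_zero n t u \<^bold>= v"
proof (rule N_cases[of _ n])
  show "\<Delta> \<tturnstile> if_zero n t u \<^bold>= v" if "\<Gamma> |\<subseteq>| \<Delta>" "\<Delta> \<tturnstile> n \<^bold>= Zero" for \<Delta>
    by (rule Eq_trans[OF if_zero_Zero[OF that(2)] weaken[OF assms(1) that(1)]])
  show "\<Delta> \<tturnstile> if_zero n t u \<^bold>= v" if "\<Gamma> |\<subseteq>| \<Delta>" "\<Delta> \<tturnstile> n \<^bold>= Succ k" for k \<Delta>
    by (rule Eq_trans[OF if_zero_Succ[OF that(2)] weaken[OF assms(2) that(1)]])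
qed

text \<open>For \<open>i = 0\<close> section 0 of \<open>axis i d\<close> is \<open>d\<close> and all later ones are zero. For \<open>i \<noteq> 0\<close> section 0
  is zero and all later ones are \<open>d\<close>.\<close>

definition axis :: "ntm \<Rightarrow> stm \<Rightarrow> stm"
  where "axis i d = Lam (if_zero (Hd (NVar 0))
    (if_zero (wkN_n i) (Ap (wkN_s d) (Tl (NVar 0))) Zero)
    (if_zero (wkN_n i) Zero (Ap (wkN_s d) (Tl (NVar 0)))))"

lemma sub_axis [simp]: "sub_s \<sigma> \<tau> (axis i d) = axis (sub_n \<sigma> \<tau> i) (sub_s \<sigma> \<tau> d)"
  by (simp add: axis_def)

lemma Ap_axis:
  "\<Gamma> \<tturnstile> Ap (axis i d) x \<^bold>=
    if_zero (Hd x) (if_zero i (Ap d (Tl x)) Zero) (if_zero i Zero (Ap d (Tl x)))"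
  unfolding axis_def by (rule Eq_trans[OF Ax[OF ax.Beta]]) (simp add: Eq_refl)

lemma sect_axis: "\<Gamma> \<tturnstile> seq_eq (sect (axis i d) i) d"
proof (rule seq_eqI, rule Eq_trans[OF Ap_sect])
  fix n
  have hd: "\<Delta> \<tturnstile> Hd (Cns i n) \<^bold>= j" if "\<Delta> \<tturnstile> i \<^bold>= j" for j \<Delta>
    by (rule Eq_trans[OF Ax[OF ax.Hd_Cns] that])
  have tl: "\<Delta> \<tturnstile> Ap d (Tl (Cns i n)) \<^bold>= Ap d n" for \<Delta>
    by (rule Ap_cong[OF Ax[OF ax.Tl_Cns]])
  show "\<Gamma> \<tturnstile> Ap (axis i d) (Cns i n) \<^bold>= Ap d n"
  proof (rule N_cases[of _ i])
    show "\<Delta> \<tturnstile> Ap (axis i d) (Cns i n) \<^bold>= Ap d n" if "\<Delta> \<tturnstile> i \<^bold>= Zero" for \<Delta>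
      by (rule Eq_trans[OF Eq_trans[OF Ap_axis if_zero_Zero[OF hd[OF that]]]
            Eq_trans[OF if_zero_Zero[OF that] tl]])
    show "\<Delta> \<tturnstile> Ap (axis i d) (Cns i n) \<^bold>= Ap d n" if "\<Delta> \<tturnstile> i \<^bold>= Succ k" for k \<Delta>
      by (rule Eq_trans[OF Eq_trans[OF Ap_axis if_zero_Succ[OF hd[OF that]]]
            Eq_trans[OF if_zero_Succ[OF that] tl]])
  qed
qed

lemma axis_in_D2A1: "\<Gamma> \<tturnstile> in_D2A1 (axis i d)"
proof (rule N_cases[of _ i])
  fix \<Delta> assume i: "\<Delta> \<tturnstile> i \<^bold>= Zero"
  have "\<Delta> \<tturnstile> Ap (sect (axis i d) (Succ Zero)) n \<^bold>= Zero" for n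
    by (rule Eq_trans[OF Eq_trans[OF Ap_sect Ap_axis]
          Eq_trans[OF if_zero_Succ[OF Ax[OF ax.Hd_Cns]] if_zero_Zero[OF i]]])
  then show "\<Delta> \<tturnstile> in_D2A1 (axis i d)" unfolding in_D2A1_def by (rule OrI2[OF seq_eq_zero_seqI])
next
  fix k \<Delta> assume i: "\<Delta> \<tturnstile> i \<^bold>= Succ k"
  have "\<Delta> \<tturnstile> Ap (sect (axis i d) Zero) n \<^bold>= Zero" for n
    by (rule Eq_trans[OF Eq_trans[OF Ap_sect Ap_axis]
          Eq_trans[OF if_zero_Zero[OF Ax[OF ax.Hd_Cns]] if_zero_Succ[OF i]]])
  then show "\<Delta> \<tturnstile> in_D2A1 (axis i d)" unfolding in_D2A1_def by (rule OrI1[OF seq_eq_zero_seqI])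
qed

lemma axis_zero_seq: "\<Gamma> \<tturnstile> seq_eq (axis i zero_seq) zero_seq"
  by (rule seq_eq_zero_seqI, rule Eq_trans[OF Ap_axis]) (intro if_zero_same Ap_zero_seq Eq_refl)

lemma zero_seq_in_D2A1: "\<Gamma> \<tturnstile> in_D2A1 zero_seq"
  unfolding in_D2A1_def by (rule OrI1[OF seq_eq_zero_seqI]) (rule Eq_trans[OF Ap_sect Ap_zero_seq])

section \<open>Functions onto \<open>D\<^sup>2(A\<^sub>1)\<close>\<close>

lemma onto_D2A1_iff:
  assumes "\<Gamma> \<tturnstile> onto_D2A1 g b"
  shows "\<Gamma> \<tturnstile> ExS (in_spread (wkS_s b) (SVar 0) \<^bold>\<and> fun_value (wkS_s g) (SVar 0) (wkS_s c))
    \<^bold>\<longleftrightarrow> in_D2A1 c"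
  using AllSE[OF assms[unfolded onto_D2A1_def], of c] by simp

lemma onto_D2A1_value:
  assumes "\<Gamma> \<tturnstile> onto_D2A1 g b" and "\<Gamma> \<tturnstile> in_spread b a" and "\<Gamma> \<tturnstile> fun_value g a c"
  shows "\<Gamma> \<tturnstile> in_D2A1 c"
  by (rule Iff_D1[OF onto_D2A1_iff[OF assms(1)] ExSI[of _ a]]) (simp add: AndI assms(2,3))

lemma onto_D2A1_preimage:
  assumes "\<Gamma> \<tturnstile> onto_D2A1 g b" and "\<Gamma> \<tturnstile> in_D2A1 c"
    and "\<And>a \<Delta>. \<Gamma> |\<subseteq>| \<Delta> \<Longrightarrow> \<Delta> \<tturnstile> in_spread b a \<Longrightarrow> \<Delta> \<tturnstile> fun_value g a c \<Longrightarrow> \<Delta> \<tturnstile> \<chi>"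
  shows "\<Gamma> \<tturnstile> \<chi>"
proof (rule ExS_elim[OF Iff_D2[OF onto_D2A1_iff[OF assms(1)] assms(2)]])
  fix a \<Delta> assume ext: "\<Gamma> |\<subseteq>| \<Delta>"
    and "\<Delta> \<tturnstile> instS a (in_spread (wkS_s b) (SVar 0) \<^bold>\<and> fun_value (wkS_s g) (SVar 0) (wkS_s c))"
  then have a: "\<Delta> \<tturnstile> in_spread b a \<^bold>\<and> fun_value g a c" by simp
  show "\<Delta> \<tturnstile> \<chi>" by (rule assms(3)[OF ext AndE1[OF a] AndE2[OF a]])
qed

definition section_vanishes :: "stm \<Rightarrow> stm \<Rightarrow> ntm \<Rightarrow> fm"
  where "section_vanishes g a i =
    ExS (fun_value (wkS_s g) (wkS_s a) (SVar 0) \<^bold>\<and> seq_eq (sect (SVar 0) (wkS_n i)) zero_seq)"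

lemma sub_section_vanishes [simp]:
  "sub \<sigma> \<tau> (section_vanishes g a i) = section_vanishes (sub_s \<sigma> \<tau> g) (sub_s \<sigma> \<tau> a) (sub_n \<sigma> \<tau> i)"
  by (simp add: section_vanishes_def)

lemma section_vanishesI:
  "\<Gamma> \<tturnstile> fun_value g a c \<Longrightarrow> \<Gamma> \<tturnstile> seq_eq (sect c i) zero_seq \<Longrightarrow> \<Gamma> \<tturnstile> section_vanishes g a i"
  unfolding section_vanishes_def by (rule ExSI[of _ c]) (simp add: AndI)

lemma section_vanishesD:
  assumes "\<Gamma> \<tturnstile> section_vanishes g a i" and "\<Gamma> \<tturnstile> fun_value g a c"
  shows "\<Gamma> \<tturnstile> seq_eq (sect c i) zero_seq"
proof (rule ExS_elim[OF assms(1)[unfolded section_vanishes_def]])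
  fix e \<Delta> assume ext: "\<Gamma> |\<subseteq>| \<Delta>"
    and "\<Delta> \<tturnstile> instS e (fun_value (wkS_s g) (wkS_s a) (SVar 0) \<^bold>\<and>
      seq_eq (sect (SVar 0) (wkS_n i)) zero_seq)"
  then have e: "\<Delta> \<tturnstile> fun_value g a e \<^bold>\<and> seq_eq (sect e i) zero_seq" by simp
  have "\<Delta> \<tturnstile> seq_eq c e" by (rule fun_value_unique[OF weaken[OF assms(2) ext] AndE1[OF e]])
  then show "\<Delta> \<tturnstile> seq_eq (sect c i) zero_seq" by (rule seq_eq_trans[OF sect_cong AndE2[OF e]])
qed

lemma some_section_vanishes:
  assumes "\<Gamma> \<tturnstile> codes_fun g b" and "\<Gamma> \<tturnstile> onto_D2A1 g b" and "\<Gamma> \<tturnstile> in_spread b a"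
  shows "\<Gamma> \<tturnstile> ExN (section_vanishes (wkN_s g) (wkN_s a) (NVar 0))"
proof (rule ExS_elim[OF fun_value_exists[OF assms(1,3)]])
  fix c \<Delta> assume ext: "\<Gamma> |\<subseteq>| \<Delta>" and "\<Delta> \<tturnstile> instS c (fun_value (wkS_s g) (wkS_s a) (SVar 0))"
  then have c: "\<Delta> \<tturnstile> fun_value g a c" by simp
  have vanishing: "\<Theta> \<tturnstile> ExN (section_vanishes (wkN_s g) (wkN_s a) (NVar 0))"
    if "\<Delta> |\<subseteq>| \<Theta>" "\<Theta> \<tturnstile> seq_eq (sect c i) zero_seq" for i \<Theta>
    by (rule ExNI[of _ i]) (simp add: section_vanishesI[OF weaken[OF c that(1)] that(2)])
  from onto_D2A1_value[OF weaken[OF assms(2) ext] weaken[OF assms(3) ext] c]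
  show "\<Delta> \<tturnstile> ExN (section_vanishes (wkN_s g) (wkN_s a) (NVar 0))"
    unfolding in_D2A1_def by (rule Or_elim) (rule vanishing, assumption+)+
qed

definition preimage_through :: "stm \<Rightarrow> stm \<Rightarrow> stm \<Rightarrow> ntm \<Rightarrow> ntm \<Rightarrow> fm"
  where "preimage_through g b e m s = ExS (in_spread (wkS_s b) (SVar 0) \<^bold>\<and>
    fun_value (wkS_s g) (SVar 0) (wkS_s e) \<^bold>\<and> (bar (SVar 0) (wkS_n m) \<^bold>= wkS_n s))"

lemma sub_preimage_through [simp]:
  "sub \<sigma> \<tau> (preimage_through g b e m s) = preimage_through (sub_s \<sigma> \<tau> g) (sub_s \<sigma> \<tau> b)
    (sub_s \<sigma> \<tau> e) (sub_n \<sigma> \<tau> m) (sub_n \<sigma> \<tau> s)"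
  by (simp add: preimage_through_def)

lemma preimage_throughE:
  assumes "\<Gamma> \<tturnstile> preimage_through g b e m s"
    and "\<And>c \<Delta>. \<Gamma> |\<subseteq>| \<Delta> \<Longrightarrow> \<Delta> \<tturnstile> in_spread b c \<Longrightarrow> \<Delta> \<tturnstile> fun_value g c e \<Longrightarrow> \<Delta> \<tturnstile> bar c m \<^bold>= s \<Longrightarrow> \<Delta> \<tturnstile> \<chi>"
  shows "\<Gamma> \<tturnstile> \<chi>"
proof (rule ExS_elim[OF assms(1)[unfolded preimage_through_def]])
  fix c \<Delta> assume ext: "\<Gamma> |\<subseteq>| \<Delta>" and "\<Delta> \<tturnstile> instS c (in_spread (wkS_s b) (SVar 0) \<^bold>\<and>
    fun_value (wkS_s g) (SVar 0) (wkS_s e) \<^bold>\<and> (bar (SVar 0) (wkS_n m) \<^bold>= wkS_n s))"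
  then have c: "\<Delta> \<tturnstile> in_spread b c \<^bold>\<and> fun_value g c e \<^bold>\<and> (bar c m \<^bold>= s)" by simp
  show "\<Delta> \<tturnstile> \<chi>" by (rule assms(2)[OF ext AndE1[OF c] AndE1[OF AndE2[OF c]] AndE2[OF AndE2[OF c]]])
qed

lemma preimage_through_exists:
  assumes "\<Gamma> \<tturnstile> onto_D2A1 g b" and "\<Gamma> \<tturnstile> in_D2A1 e"
  shows "\<Gamma> \<tturnstile> ExN (preimage_through (wkN_s g) (wkN_s b) (wkN_s e) (wkN_n m) (NVar 0))"
proof (rule onto_D2A1_preimage[OF assms])
  fix c \<Delta> assume c: "\<Delta> \<tturnstile> in_spread b c" "\<Delta> \<tturnstile> fun_value g c e"
  have "\<Delta> \<tturnstile> preimage_through g b e m (bar c m)"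
    unfolding preimage_through_def by (rule ExSI[of _ c]) (simp add: AndI c Eq_refl)
  then show "\<Delta> \<tturnstile> ExN (preimage_through (wkN_s g) (wkN_s b) (wkN_s e) (wkN_n m) (NVar 0))"
    by (intro ExNI[of _ "bar c m"]) simp
qed

section \<open>Two points with the same value\<close>

definition collision :: "stm \<Rightarrow> stm \<Rightarrow> fm"
  where "collision g b = ExS (ExS (
    in_spread (wkS_s (wkS_s b)) (SVar 1) \<^bold>\<and> in_spread (wkS_s (wkS_s b)) (SVar 0) \<^bold>\<and>
    apart (SVar 1) (SVar 0) \<^bold>\<and>
    ExS (fun_value (wkS_s (wkS_s (wkS_s g))) (SVar 2) (SVar 0) \<^bold>\<and>
      fun_value (wkS_s (wkS_s (wkS_s g))) (SVar 1) (SVar 0))))"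

lemma sub_collision [simp]: "sub \<sigma> \<tau> (collision g b) = collision (sub_s \<sigma> \<tau> g) (sub_s \<sigma> \<tau> b)"
  by (simp add: collision_def)

lemma collisionI:
  assumes "\<Gamma> \<tturnstile> in_spread b a" and "\<Gamma> \<tturnstile> in_spread b a'" and "\<Gamma> \<tturnstile> apart a a'"
    and "\<Gamma> \<tturnstile> fun_value g a c" and "\<Gamma> \<tturnstile> fun_value g a' c"
  shows "\<Gamma> \<tturnstile> collision g b"
proof -
  have common_value:
    "\<Gamma> \<tturnstile> ExS (fun_value (wkS_s g) (wkS_s a) (SVar 0) \<^bold>\<and> fun_value (wkS_s g) (wkS_s a') (SVar 0))"
    by (rule ExSI[of _ c]) (simp add: AndI assms(4,5))
  show ?thesis
    unfolding collision_def
    by (rule ExSI[of _ a], simp, rule ExSI[of _ a'])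
      (use common_value in \<open>simp add: AndI assms(1-3)\<close>)
qed

text \<open>The initial segments up to \<open>m\<close> of \<open>a\<close> and of \<open>c\<close> must differ: otherwise \<open>c'\<close> would be near
  \<open>a\<close>, although section \<open>i\<close> of \<open>g|c'\<close> is \<open>d\<close>.\<close>

lemma collision_of_preimages:
  assumes a: "\<Gamma> \<tturnstile> in_spread b a" "\<Gamma> \<tturnstile> fun_value g a zero_seq"
    and near: "\<Gamma> \<tturnstile> all_near b a m (section_vanishes (wkS_s g) (SVar 0) (wkS_n i))"
    and c: "\<Gamma> \<tturnstile> in_spread b c" "\<Gamma> \<tturnstile> fun_value g c (axis i zero_seq)"
    and c': "\<Gamma> \<tturnstile> in_spread b c'" "\<Gamma> \<tturnstile> fun_value g c' (axis i d)"
    and eq: "\<Gamma> \<tturnstile> bar c m \<^bold>= bar c' m" and d: "\<Gamma> \<tturnstile> apart d zero_seq"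
  shows "\<Gamma> \<tturnstile> collision g b"
proof (rule Or_elim[OF bar_eq_or_apart[of _ c m a]])
  fix \<Delta> assume ext: "\<Gamma> |\<subseteq>| \<Delta>"
  note in_ext = weaken[OF _ ext]
  show "\<Delta> \<tturnstile> collision g b" if "\<Delta> \<tturnstile> apart c a"
    by (rule collisionI[OF in_ext[OF c(1)] in_ext[OF a(1)] that
          fun_value_cong[OF in_ext[OF c(2)] axis_zero_seq] in_ext[OF a(2)]])
  show "\<Delta> \<tturnstile> collision g b" if "\<Delta> \<tturnstile> bar c m \<^bold>= bar a m"
  proof -
    have "\<Delta> \<tturnstile> bar c' m \<^bold>= bar a m" by (rule Eq_trans[OF Eq_sym[OF in_ext[OF eq]] that])
    from all_nearD[OF in_ext[OF near] in_ext[OF c'(1)] this]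
    have "\<Delta> \<tturnstile> section_vanishes g c' i" by simp
    from section_vanishesD[OF this in_ext[OF c'(2)]]
    have "\<Delta> \<tturnstile> seq_eq d zero_seq" by (rule seq_eq_trans[OF seq_eq_sym[OF sect_axis]])
    with in_ext[OF d] show ?thesis by (rule apart_seq_eq)
  qed
qed

lemma collision_of_preimages_near_zero_seq:
  assumes a: "\<Gamma> \<tturnstile> in_spread b a" "\<Gamma> \<tturnstile> fun_value g a zero_seq"
    and near: "\<Gamma> \<tturnstile> all_near b a m (section_vanishes (wkS_s g) (SVar 0) (wkS_n i))"
    and preimages: "\<Gamma> \<tturnstile> all_near zero_seq zero_seq n
      (preimage_through (wkS_s g) (wkS_s b) (axis (wkS_n i) (SVar 0)) (wkS_n m) (wkS_n s))"
  shows "\<Gamma> \<tturnstile> collision g b"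
proof (rule ExS_elim[OF near_zero_seq_apart[of _ n]])
  have through: "\<Delta> \<tturnstile> preimage_through g b (axis i d) m s"
    if "\<Gamma> |\<subseteq>| \<Delta>" "\<Delta> \<tturnstile> bar d n \<^bold>= bar zero_seq n" for d \<Delta>
    using all_nearD[OF weaken[OF preimages that(1)] in_spread_zero_seq that(2)] by simp
  fix d \<Delta> assume ext: "\<Gamma> |\<subseteq>| \<Delta>"
    and "\<Delta> \<tturnstile> instS d ((bar (SVar 0) (wkS_n n) \<^bold>= bar zero_seq (wkS_n n)) \<^bold>\<and>
      apart (SVar 0) zero_seq)"
  then have d: "\<Delta> \<tturnstile> (bar d n \<^bold>= bar zero_seq n) \<^bold>\<and> apart d zero_seq" by simp
  show "\<Delta> \<tturnstile> collision g b"
  proof (rule preimage_throughE[OF through[OF ext AndE1[OF d]]])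
    fix c' \<Theta> assume c': "\<Theta> \<tturnstile> in_spread b c'" "\<Theta> \<tturnstile> fun_value g c' (axis i d)" "\<Theta> \<tturnstile> bar c' m \<^bold>= s"
      and ext': "\<Delta> |\<subseteq>| \<Theta>"
    show "\<Theta> \<tturnstile> collision g b"
    proof (rule preimage_throughE[OF through[OF order_trans[OF ext ext'] Eq_refl]])
      fix c \<Lambda> assume c: "\<Lambda> \<tturnstile> in_spread b c" "\<Lambda> \<tturnstile> fun_value g c (axis i zero_seq)" "\<Lambda> \<tturnstile> bar c m \<^bold>= s"
        and ext'': "\<Theta> |\<subseteq>| \<Lambda>"
      note in_\<Lambda> = weaken[OF weaken[OF weaken[OF _ ext] ext'] ext'']
      have "\<Lambda> \<tturnstile> bar c m \<^bold>= bar c' m" by (rule Eq_trans[OF c(3) Eq_sym[OF weaken[OF c'(3) ext'']]])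
      then show "\<Lambda> \<tturnstile> collision g b"
        by (rule collision_of_preimages[OF in_\<Lambda>[OF a(1)] in_\<Lambda>[OF a(2)] in_\<Lambda>[OF near] c(1,2)
              weaken[OF c'(1) ext''] weaken[OF c'(2) ext''] _
              weaken[OF weaken[OF AndE2[OF d] ext'] ext'']])
    qed
  qed
qed

lemma collision_of_section_vanishing_near:
  assumes onto: "\<Gamma> \<tturnstile> onto_D2A1 g b" and a: "\<Gamma> \<tturnstile> in_spread b a" "\<Gamma> \<tturnstile> fun_value g a zero_seq"
    and near: "\<Gamma> \<tturnstile> all_near b a m (section_vanishes (wkS_s g) (SVar 0) (wkS_n i))"
  shows "\<Gamma> \<tturnstile> collision g b"
proof -
  let ?preimage = "preimage_through (wkN_s (wkS_s g)) (wkN_s (wkS_s b))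
    (axis (wkN_n (wkS_n i)) (SVar 0)) (wkN_n (wkS_n m)) (NVar 0)"
  show ?thesis
  proof (rule continuity_principle[OF spread_law_zero_seq in_spread_zero_seq[of _ zero_seq],
        where \<phi> = ?preimage])
    fix d \<Delta> assume ext: "\<Gamma> |\<subseteq>| \<Delta>"
    show "\<Delta> \<tturnstile> instS d (ExN ?preimage)"
      using preimage_through_exists[OF weaken[OF onto ext] axis_in_D2A1, of i d m] by simp
  next
    fix n s \<Delta> assume ext: "\<Gamma> |\<subseteq>| \<Delta>"
      and "\<Delta> \<tturnstile> all_near zero_seq zero_seq n (instN (wkS_n s) ?preimage)"
    from this(2) show "\<Delta> \<tturnstile> collision g b"
      by (intro collision_of_preimages_near_zero_seq[OF weaken[OF a(1) ext] weaken[OF a(2) ext]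
            weaken[OF near ext], of n s]) simp
  qed
qed

lemma collision_of_onto:
  assumes spread: "\<Gamma> \<tturnstile> spread_law b" and codes: "\<Gamma> \<tturnstile> codes_fun g b" and onto: "\<Gamma> \<tturnstile> onto_D2A1 g b"
  shows "\<Gamma> \<tturnstile> collision g b"
proof (rule onto_D2A1_preimage[OF onto zero_seq_in_D2A1])
  fix a \<Delta> assume ext: "\<Gamma> |\<subseteq>| \<Delta>" and a: "\<Delta> \<tturnstile> in_spread b a" "\<Delta> \<tturnstile> fun_value g a zero_seq"
  let ?vanishing = "section_vanishes (wkN_s (wkS_s g)) (SVar 0) (NVar 0)"
  show "\<Delta> \<tturnstile> collision g b"
  proof (rule continuity_principle[OF weaken[OF spread ext] a(1), where \<phi> = ?vanishing])
    fix c \<Theta> assume ext': "\<Delta> |\<subseteq>| \<Theta>" and c: "\<Theta> \<tturnstile> in_spread b c"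
    note in_\<Theta> = weaken[OF weaken[OF _ ext] ext']
    show "\<Theta> \<tturnstile> instS c (ExN ?vanishing)"
      using some_section_vanishes[OF in_\<Theta>[OF codes] in_\<Theta>[OF onto] c] by simp
  next
    fix m i \<Theta> assume ext': "\<Delta> |\<subseteq>| \<Theta>" and "\<Theta> \<tturnstile> all_near b a m (instN (wkS_n i) ?vanishing)"
    from this(2) show "\<Theta> \<tturnstile> collision g b"
      by (intro collision_of_section_vanishing_near[OF weaken[OF weaken[OF onto ext] ext']
            weaken[OF a(1) ext'] weaken[OF a(2) ext'], of m i]) simp
  qed
qed

theorem theorem6p5:
  shows "{} \<turnstile> AllS (AllS (
    spread_law (SVar 1) \<^bold>\<and> codes_fun (SVar 0) (SVar 1) \<^bold>\<and> onto_D2A1 (SVar 0) (SVar 1) \<^bold>\<longrightarrow>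
    ExS (ExS (
      in_spread (SVar 3) (SVar 1) \<^bold>\<and> in_spread (SVar 3) (SVar 0) \<^bold>\<and>
      apart (SVar 1) (SVar 0) \<^bold>\<and>
      ExS (fun_value (SVar 3) (SVar 2) (SVar 0) \<^bold>\<and> fun_value (SVar 3) (SVar 1) (SVar 0))))))"
proof -
  have "{||} \<tturnstile> spread_law b \<^bold>\<and> codes_fun g b \<^bold>\<and> onto_D2A1 g b \<^bold>\<longrightarrow> collision g b" for b g
    by (rule Imp_intro) (rule collision_of_onto[OF AndE1 AndE1[OF AndE2] AndE2[OF AndE2]])
  then have "{||} \<tturnstile> AllS (spread_law (wkS_s b) \<^bold>\<and> codes_fun (SVar 0) (wkS_s b) \<^bold>\<and>
      onto_D2A1 (SVar 0) (wkS_s b) \<^bold>\<longrightarrow> collision (SVar 0) (wkS_s b))" for b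
    by (intro AllS_intro) simp
  then have "{||} \<tturnstile> AllS (AllS (spread_law (SVar 1) \<^bold>\<and> codes_fun (SVar 0) (SVar 1) \<^bold>\<and>
      onto_D2A1 (SVar 0) (SVar 1) \<^bold>\<longrightarrow> collision (SVar 0) (SVar 1)))"
    by (intro AllS_intro[of "{||}" "AllS \<phi>" for \<phi>]) simp
  then show ?thesis by (simp add: collision_def)
qed

end
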